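(* For $\phi\in(0,\pi)$ let $$\gamma(\phi) = \cos(\phi/2)\, \frac{\mathcal F_\phi}{\mathcal R_\phi}.$$ Then, for every $\phi \in (0,\pi)$, the problem $\mathcal P\text{-MSP}_2(1,\gamma(\phi))$ (searching the plane with two agents, of speeds $1$ and $\gamma(\phi)$) admits a solution with search cost equal to $\mathcal R_\phi$, which also equals $\cos(\phi/2)\,\mathcal F_\phi/\gamma(\phi)$.
   Context: For $\phi\in(0,\pi)$: $\mathcal F_\phi$ is the minimum over $\theta\in(\phi,\pi/2+\phi/2)$ of $\left(\frac{\sin\theta}{\sin(\theta-\phi)}\right)^2\frac1{\cos(\theta-\phi/2)}$; $\mathcal R_\phi$ is the minimum over $\lambda\in(1,\infty)$ of $\frac{\sqrt{\lambda^2-2\lambda\cos\phi+1}}{\lambda-1}e^{2\pi k_\lambda}$, where $k_\lambda=\frac{\ln\lambda}{2\pi}+\frac{\lambda-1}{\sqrt{2\lambda(1-\cos\phi)}}\left(1-\frac{\phi}{2\pi}\right)$. Polar notation: $\langle \rho,\chi\rangle = \rho(\cos\chi,\sin\chi)$. A point $P=\langle x,\psi\rangle$ exposes $A=\langle y,\psi\rangle$ (with $x,y>0$, same ray from the origin) if $x\ge y$. $[n]=\{0,\dots,n-1\}$. $\mathcal P=\mathbb R^2\setminus\{(0,0)\}$. Problem $\mathcal D\text{-MSP}_n(c)$, for a search domain $\mathcal D\subseteq\mathbb R^2\setminus\{(0,0)\}$ and speeds $c=(c_0,\dots,c_{n-1})$: a feasible solution consists of continuous, piecewise differentiable curves $\tau_i:\mathbb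 R\to\mathbb R^2$, $i\in[n]$, with $\lim_{t\to-\infty}\tau_i(t)=(0,0)$, such that every $A\in\mathcal D$ is exposed by some point $\tau_i(t)$ of some curve. The parameter $t$ is not physical time: agent $i$ moves along $\tau_i$ at speed $c_i$, so it reaches $\tau_i(t)$ at time $\ell_i(t)/c_i$, where $\ell_i(t)=\int_{-\infty}^t\|\tau_i'(u)\|\,du$. If $t_A^i$ is the earliest parameter at which $\tau_i(t_A^i)$ exposes $A$ (infinite if none), the search cost of the solution is $\sup_{A\in\mathcal D}\frac1{\|A\|}\min_{i\in[n]}\frac{\ell_i(t_A^i)}{c_i}$. "Admits a solution with search cost $S$" means there is a feasible solution whose search cost equals $S$. *)

theory Defs
  imports "HOL-Analysis.Analysis"
begin

definition F_min :: "real \<Rightarrow> real" where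
  "F_min \<phi> = (LEAST v. v \<in> (\<lambda>\<theta>. (sin \<theta> / sin (\<theta> - \<phi>))\<^sup>2 * (1 / cos (\<theta> - \<phi> / 2)))
                          ` {\<phi><..<pi / 2 + \<phi> / 2})"

definition k_exp :: "real \<Rightarrow> real \<Rightarrow> real" where
  "k_exp \<phi> l = ln l / (2 * pi)
     + (l - 1) / sqrt (2 * l * (1 - cos \<phi>)) * (1 - \<phi> / (2 * pi))"

definition R_min :: "real \<Rightarrow> real" where
  "R_min \<phi> = (LEAST v. v \<in> (\<lambda>l. sqrt (l\<^sup>2 - 2 * l * cos \<phi> + 1) / (l - 1)
                               * exp (2 * pi * k_exp \<phi> l)) ` {1<..})"

definition speed_ratio :: "real \<Rightarrow> real" where
  "speed_ratio \<phi> = cos (\<phi> / 2) * (F_min \<phi> / R_min \<phi>)"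

text \<open>The plane is \<^typ>\<open>real \<times> real\<close>, whose library norm is the Euclidean one.\<close>

definition polar :: "real \<Rightarrow> real \<Rightarrow> real \<times> real" where
  "polar \<rho> \<psi> = (\<rho> * cos \<psi>, \<rho> * sin \<psi>)"

definition exposes :: "real \<times> real \<Rightarrow> real \<times> real \<Rightarrow> bool" where
  "exposes P A \<longleftrightarrow>
     (\<exists>x y \<psi>. x > 0 \<and> y > 0 \<and> P = polar x \<psi> \<and> A = polar y \<psi> \<and> x \<ge> y)"

definition punctured_plane :: "(real \<times> real) set" where
  "punctured_plane = UNIV - {(0, 0)}"

text \<open>A curve on the whole line may have infinitely many breakpoints (they typically
  accumulate at minus infinity in the parameter), but only finitely many in each compact
  parameter interval; the library predicate allows only finitely many, so it is required on
  each compact interval.\<close>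

definition search_curve :: "(real \<Rightarrow> real \<times> real) \<Rightarrow> bool" where
  "search_curve \<tau> \<longleftrightarrow> continuous_on UNIV \<tau> \<and>
     (\<forall>a b. \<tau> piecewise_differentiable_on {a..b}) \<and>
     (\<tau> \<longlongrightarrow> (0, 0)) at_bot"

definition feasible :: "(real \<times> real) set \<Rightarrow> nat \<Rightarrow> (nat \<Rightarrow> real \<Rightarrow> real \<times> real) \<Rightarrow> bool" where
  "feasible D n \<tau> \<longleftrightarrow> (\<forall>i<n. search_curve (\<tau> i)) \<and>
     (\<forall>A\<in>D. \<exists>i<n. \<exists>t. exposes (\<tau> i t) A)"

text \<open>The length of the curve up to parameter \<open>t\<close>, possibly infinite.  The value of
  \<^const>\<open>vector_derivative\<close> is unspecified at the breakpoints, which form a null set.\<close>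

definition len_upto :: "(real \<Rightarrow> real \<times> real) \<Rightarrow> real \<Rightarrow> ennreal" where
  "len_upto \<tau> t = (\<integral>\<^sup>+u\<in>{..t}. ennreal (norm (vector_derivative \<tau> (at u))) \<partial>lborel)"

text \<open>The physical time at which an agent of speed \<open>s\<close> on \<open>\<tau>\<close> first exposes \<open>A\<close>.  For a
  search curve the exposing parameters form a closed set that is bounded below, so a least one
  exists as soon as there is any.  An agent that never exposes \<open>A\<close> has infinite exposure
  time, even if its curve has finite total length.\<close>

definition exposure_time :: "(real \<Rightarrow> real \<times> real) \<Rightarrow> real \<Rightarrow> real \<times> real \<Rightarrow> ennreal" where
  "exposure_time \<tau> s A =
     (if \<exists>t. exposes (\<tau> t) A then len_upto \<tau> (LEAST t. exposes (\<tau> t) A) / ennreal s else \<infinity>)"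

definition search_cost ::
  "(real \<times> real) set \<Rightarrow> nat \<Rightarrow> (nat \<Rightarrow> real) \<Rightarrow> (nat \<Rightarrow> real \<Rightarrow> real \<times> real) \<Rightarrow> ennreal" where
  "search_cost D n c \<tau> =
     (SUP A\<in>D. ennreal (1 / norm A) * (MIN i\<in>{..<n}. exposure_time (\<tau> i) (c i) A))"

definition MSP_admits :: "(real \<times> real) set \<Rightarrow> nat \<Rightarrow> (nat \<Rightarrow> real) \<Rightarrow> real \<Rightarrow> bool" where
  "MSP_admits D n c S \<longleftrightarrow>
     (\<exists>\<tau>. feasible D n \<tau> \<and> enn2ereal (search_cost D n c \<tau>) = ereal S)"

end

theory Submission imports Defs
begin

text \<open>With \<open>h = tan (\<phi> / 2)\<close> and \<open>w = tan (\<theta> - \<phi> / 2) / h\<close> the objective defining \<open>F_min\<close> becomes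
  \<open>((w + 1) / (w - 1))\<^sup>2 * sqrt (1 + h\<^sup>2 * w\<^sup>2)\<close>.

  If \<open>h \<le> 3 / 4\<close>, the agent of speed 1 follows a logarithmic spiral outside a wedge of opening
  \<open>\<phi>\<close> and crosses the wedge along a chord, with the spiral rate for which the length travelled is the
  same multiple of the radius at both ends of the chord; the other agent zigzags between the two sides
  of the wedge. The first-order condition for the optimal \<open>w\<close> yields \<open>h * w \<le> 4\<close>, and this
  makes the boundary directions the most expensive ones inside the wedge.

  For \<open>\<phi>\<close> close to \<open>\<pi>\<close> that last claim is false: the zigzag passes so close to the origin that
  interior directions cost more. If \<open>h > 3 / 4\<close>, however, two logarithmic spirals of a common rate
  are already better than required at these speeds, so by the intermediate value theorem
  the rate can be increased until the cost is exactly \<open>R_min \<phi>\<close>.\<close>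

section \<open>Exposure times\<close>

text \<open>The speed ratio balances the agents: on a side of the wedge the zigzag costs
  \<open>cos (\<phi> / 2) * F_min \<phi> / speed_ratio \<phi>\<close>, which is
  \<open>R_min \<phi>\<close>. The cost has to equal this value, not merely stay below it, so each
  construction also needs near-worst points, found just beyond a point that an agent has passed: for
  the cut spiral on the negative axis, which the zigzag never exposes, and for two spirals on the
  positive axis.

  For two spirals of rate \<open>k\<close> let \<open>q = sqrt (1 + 1 / k\<^sup>2)\<close> be the
  length per radius and \<open>E = exp (2 * pi * k)\<close> the growth per turn. With a suitable
  ratio of radii both agents cost \<open>S\<close> when
  \<open>q\<^sup>2 * E = c * S\<^sup>2\<close>. The left side drops below 81 for a suitable
  \<open>k\<close>, so this regime rests on numerical bounds: \<open>R_min \<phi>\<close> is at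
  least 12 for every \<open>\<phi>\<close>, and \<open>speed_ratio \<phi> * R_min \<phi>\<close> is
  at least 34/5 if \<open>h\<close> is at least 3/4. Their product 408/5 = 81.6 leaves little room,
  so the estimates cannot be crude.\<close>

lemma norm_polar [simp]: "norm (polar r t) = \<bar>r\<bar>"
  by (simp add: polar_def norm_Pair power_mult_distrib flip: distrib_left)

lemma polar_scaleR: "polar r t = r *\<^sub>R polar 1 t"
  by (simp add: polar_def)

lemma polar_form:
  obtains \<psi> where "0 \<le> \<psi>" "\<psi> < 2 * pi" "A = polar (norm A) \<psi>"
proof (cases "A = 0")
  case True
  then show ?thesis
    using that[of 0] by (simp add: polar_def zero_prod_def)
next
  case False
  have "(fst A / norm A)\<^sup>2 + (snd A / norm A)\<^sup>2 = ((fst A)\<^sup>2 + (snd A)\<^sup>2) / (norm A)\<^sup>2"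
    by (simp add: power_divide add_divide_distrib)
  also have "\<dots> = 1"
    using False by (simp add: norm_prod_def sum_power2_eq_zero_iff prod_eq_iff)
  finally obtain \<psi> where \<psi>: "0 \<le> \<psi>" "\<psi> < 2 * pi"
      "fst A / norm A = cos \<psi>" "snd A / norm A = sin \<psi>"
    by (rule sincos_total_2pi)
  have "A = polar (norm A) \<psi>"
    unfolding polar_def \<psi>(3,4)[symmetric] using False by simp
  with \<psi>(1,2) show ?thesis
    by (rule that)
qed

text \<open>Trades the polar angle, which is determined only modulo a full turn, for a scalar
  factor.\<close>

lemma exposes_iff: "exposes P A \<longleftrightarrow> A \<noteq> 0 \<and> (\<exists>c\<ge>1. P = c *\<^sub>R A)"
proof
  assume "exposes P A"
  then obtain x y \<psi> where *: "x > 0" "y > 0" "P = polar x \<psi>" "A = polar y \<psi>" "y \<le> x"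
    by (auto simp: exposes_def)
  then have "norm A > 0"
    by simp
  moreover have "P = (x / y) *\<^sub>R A" "x / y \<ge> 1"
    using * by (auto simp: polar_def)
  ultimately show "A \<noteq> 0 \<and> (\<exists>c\<ge>1. P = c *\<^sub>R A)"
    by (auto simp del: scaleR_eq_0_iff)
next
  assume "A \<noteq> 0 \<and> (\<exists>c\<ge>1. P = c *\<^sub>R A)"
  then obtain c where "A \<noteq> 0" "c \<ge> 1" "P = c *\<^sub>R A"
    by blast
  moreover obtain \<psi> where \<psi>: "A = polar (norm A) \<psi>"
    by (rule polar_form)
  moreover have "c *\<^sub>R A = polar (c * norm A) \<psi>"
    by (subst \<psi>) (simp add: polar_def)
  ultimately show "exposes P A"
    unfolding exposes_def
    by (intro exI[of _ "c * norm A"] exI[of _ "norm A"] exI[of _ \<psi>]) auto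
qed

lemma exposesE:
  assumes "exposes P A"
  obtains c where "c \<ge> 1" "P = c *\<^sub>R A"
  using assms unfolding exposes_iff by (elim exE conjE)

lemma closed_exposes: "closed {P. exposes P A}"
proof (cases "A = 0")
  case False
  \<comment> \<open>The equation says, without a division, that \<open>P\<close> is a nonnegative
    multiple of \<open>A\<close>. It also holds for \<open>P = 0\<close>, which the condition on the
    norms removes.\<close>
  have "{P. exposes P A} = {P. norm P *\<^sub>R A = norm A *\<^sub>R P} \<inter> {P. norm A \<le> norm P}" (is "?L = ?R")
  proof (intro equalityI subsetI)
    fix P assume "P \<in> ?R"
    then have "norm A *\<^sub>R P = norm P *\<^sub>R A"
      by simp
    then have "(1 / norm A) *\<^sub>R (norm A *\<^sub>R P) = (1 / norm A) *\<^sub>R (norm P *\<^sub>R A)"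
      by (rule arg_cong)
    then have "P = (norm P / norm A) *\<^sub>R A" "norm P / norm A \<ge> 1"
      using False \<open>P \<in> ?R\<close> by auto
    with False show "P \<in> ?L"
      unfolding exposes_iff by blast
  qed (auto simp: exposes_iff mult_le_cancel_right1)
  also have "closed \<dots>"
    by (intro closed_Int closed_Collect_eq closed_Collect_le continuous_intros)
  finally show ?thesis .
qed (simp add: exposes_iff)

text \<open>The limit at minus infinity keeps early points too close to the origin to expose
  \<open>A\<close>, so the exposing parameters are bounded below; closedness then puts their infimum
  among them.\<close>

lemma ex_least_exposing:
  assumes "search_curve \<tau>" and "exposes (\<tau> t) A"
  shows "\<exists>s. exposes (\<tau> s) A \<and> (\<forall>u. exposes (\<tau> u) A \<longrightarrow> s \<le> u)"
proof -
  let ?S = "{u. exposes (\<tau> u) A}"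
  have A: "norm A > 0"
    using assms(2) by (simp add: exposes_iff)
  have "(\<tau> \<longlongrightarrow> 0) at_bot"
    using assms(1) by (simp add: search_curve_def zero_prod_def)
  then have "\<forall>\<^sub>F u in at_bot. norm (\<tau> u) < norm A"
    using A by (metis order_tendstoD(2) norm_zero tendsto_norm)
  then obtain N where N: "\<And>u. u \<le> N \<Longrightarrow> norm (\<tau> u) < norm A"
    by (auto simp: eventually_at_bot_linorder)
  have "N \<le> u" if "u \<in> ?S" for u
  proof (rule ccontr)
    assume "\<not> N \<le> u"
    then have "norm (\<tau> u) < norm A"
      using N by simp
    then show False
      using that A by (auto simp: exposes_iff mult_less_cancel_right2)
  qed
  then have bdd: "bdd_below ?S"
    by (rule bdd_belowI)
  have "closed (\<tau> -` {P. exposes P A})"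
    using assms(1) closed_exposes unfolding search_curve_def
    by (intro closed_vimage) auto
  then have "Inf ?S \<in> ?S"
    using bdd assms(2) closed_contains_Inf[of ?S] by (auto simp: vimage_def)
  then show ?thesis
    using cInf_lower[OF _ bdd] by blast
qed

lemma exposure_time_le:
  assumes "search_curve \<tau>" "exposes (\<tau> t) A" "len_upto \<tau> t \<le> ennreal b" "s > 0"
  shows "exposure_time \<tau> s A \<le> ennreal (b / s)"
proof -
  obtain u where u: "exposes (\<tau> u) A" "\<And>v. exposes (\<tau> v) A \<Longrightarrow> u \<le> v"
    using ex_least_exposing[OF assms(1,2)] by blast
  then have "(LEAST t. exposes (\<tau> t) A) = u"
    by (intro Least_equality)
  moreover have "len_upto \<tau> u \<le> len_upto \<tau> t"
    unfolding len_upto_def using u(2)[OF assms(2)]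
    by (intro nn_integral_mono) (auto simp: indicator_def)
  ultimately have "exposure_time \<tau> s A \<le> ennreal b / ennreal s"
    using assms(2,3) by (auto simp: exposure_time_def intro!: divide_right_mono_ennreal)
  \<comment> \<open>For negative \<open>b\<close> the left side is 0, since \<open>ennreal\<close>
    sends negative reals to 0.\<close>
  also have "\<dots> \<le> ennreal (b / s)"
    using assms(4) by (cases "b \<ge> 0") (simp_all add: divide_ennreal ennreal_neg)
  finally show ?thesis .
qed

text \<open>Bounding the length at every exposing parameter covers the first one without locating
  it.\<close>

lemma exposure_time_ge:
  assumes "search_curve \<tau>" "s > 0" "b \<ge> 0"
    and "\<And>t. exposes (\<tau> t) A \<Longrightarrow> ennreal b \<le> len_upto \<tau> t"
  shows "ennreal (b / s) \<le> exposure_time \<tau> s A"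
proof (cases "\<exists>t. exposes (\<tau> t) A")
  case True
  then obtain u where u: "exposes (\<tau> u) A" "\<And>v. exposes (\<tau> v) A \<Longrightarrow> u \<le> v"
    using ex_least_exposing[OF assms(1)] by blast
  then have "(LEAST t. exposes (\<tau> t) A) = u"
    by (intro Least_equality)
  then have "exposure_time \<tau> s A = len_upto \<tau> u / ennreal s"
    using True by (simp add: exposure_time_def)
  moreover have "ennreal (b / s) = ennreal b / ennreal s"
    using assms(2,3) by (simp add: divide_ennreal)
  ultimately show ?thesis
    using assms(4)[OF u(1)] by (simp add: divide_right_mono_ennreal)
qed (simp add: exposure_time_def)

text \<open>The fundamental theorem of calculus gives the length over \<open>{t - n..t}\<close> as
  \<open>L t - L (t - n)\<close>, with \<open>S\<close> holding the breakpoints. Monotone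
  convergence and the limit of \<open>L\<close> at minus infinity remove the second term.\<close>

lemma len_upto_eqI:
  assumes "continuous_on UNIV L" and "(L \<longlongrightarrow> 0) at_bot"
    and "\<And>a b. finite ({a..b} \<inter> S)"
    and deriv: "\<And>u. u \<notin> S \<Longrightarrow> (L has_real_derivative norm (vector_derivative \<tau> (at u))) (at u)"
  shows "len_upto \<tau> t = ennreal (L t)"
proof -
  define f where "f u = norm (vector_derivative \<tau> (at u))" for u
  define g where "g n u = ennreal (f u) * indicator {t - real n..t} u" for n u
  have I: "(f has_integral (L t - L a)) {a..t}" if "a \<le> t" for a
    using that assms(3)[of a t] deriv unfolding f_def
    by (intro fundamental_theorem_of_calculus_interior_strong[of "{a..t} \<inter> S"]
        continuous_on_subset[OF assms(1)])
      (auto simp: has_real_derivative_iff_has_vector_derivative)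
  have g_int: "integral\<^sup>N lborel (g n) = ennreal (L t - L (t - n))" for n
    unfolding g_def
    by (rule nn_integral_has_integral_lebesgue'[OF _ I]) (auto simp: f_def)
  \<comment> \<open>The integral at hand yields Lebesgue rather than Borel measurability, hence the
    passage to the completed measure below.\<close>
  have meas: "g n \<in> borel_measurable lebesgue" for n
  proof -
    have "(\<lambda>u. indicator {t - real n..t} u *\<^sub>R f u) \<in> borel_measurable lebesgue"
      using has_integral_implies_lebesgue_measurable[OF I, of "t - real n"] by simp
    then have "(\<lambda>u. ennreal (indicator {t - real n..t} u *\<^sub>R f u)) \<in> borel_measurable lebesgue"
      by measurable
    also have "(\<lambda>u. ennreal (indicator {t - real n..t} u *\<^sub>R f u)) = g n"
      by (auto simp: g_def fun_eq_iff indicator_def)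
    finally show ?thesis .
  qed
  have inc: "incseq g"
    by (auto simp: incseq_def le_fun_def g_def indicator_def)
  have sup: "(\<lambda>u. ennreal (f u) * indicator {..t} u) = (\<lambda>u. SUP n. g n u)"
  proof
    fix u
    obtain N where N: "t - u \<le> real N"
      using real_arch_simple by blast
    show "ennreal (f u) * indicator {..t} u = (SUP n. g n u)"
    proof (rule antisym)
      show "ennreal (f u) * indicator {..t} u \<le> (SUP n. g n u)"
        using N by (intro SUP_upper2[of N]) (auto simp: g_def indicator_def)
    qed (auto intro!: SUP_least simp: g_def indicator_def)
  qed
  have "len_upto \<tau> t = (\<integral>\<^sup>+u. (SUP n. g n u) \<partial>lebesgue)"
    unfolding len_upto_def nn_integral_completion sup[symmetric] f_def ..
  also have "\<dots> = (SUP n. ennreal (L t - L (t - real n)))"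
    by (subst nn_integral_monotone_convergence_SUP[OF inc meas])
      (simp only: nn_integral_completion g_int)
  also have "\<dots> = ennreal (L t)"
  proof (rule LIMSEQ_unique[OF LIMSEQ_SUP])
    show "incseq (\<lambda>n. ennreal (L t - L (t - real n)))"
      unfolding g_int[symmetric] using inc
      by (auto simp: incseq_def le_fun_def intro!: nn_integral_mono)
    have "filterlim (\<lambda>n. t - real n) at_bot sequentially"
      unfolding filterlim_at_bot
    proof
      fix Z :: real
      have "t - real n \<le> Z" if "n \<ge> nat \<lceil>t - Z\<rceil>" for n
        using that by linarith
      then show "\<forall>\<^sub>F n in sequentially. t - real n \<le> Z"
        by (rule eventually_sequentiallyI)
    qed
    then have "((\<lambda>n. L (t - real n)) \<longlongrightarrow> 0) sequentially"
      by (rule filterlim_compose[OF assms(2)])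
    then have "(\<lambda>n. L t - L (t - real n)) \<longlonglongrightarrow> L t - 0"
      by (intro tendsto_intros)
    then show "(\<lambda>n. ennreal (L t - L (t - real n))) \<longlonglongrightarrow> ennreal (L t)"
      by (simp add: tendsto_ennrealI)
  qed
  finally show ?thesis .
qed

text \<open>The supremum may fail to be attained, so \<open>lower\<close> asks for points of cost at
  least \<open>S / (1 + e)\<close>, and \<open>e\<close> then tends to 0.\<close>

lemma MSP2_admitsI:
  assumes "search_curve \<tau>0" "search_curve \<tau>1" "S \<ge> 0"
    and upper: "\<And>A. A \<noteq> 0 \<Longrightarrow> exposure_time \<tau>0 s0 A \<le> ennreal (S * norm A) \<or>
                      exposure_time \<tau>1 s1 A \<le> ennreal (S * norm A)"
    and lower: "\<And>e. e > 0 \<Longrightarrow> \<exists>A. A \<noteq> 0 \<and>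
                      ennreal (S * norm A / (1 + e)) \<le> exposure_time \<tau>0 s0 A \<and>
                      ennreal (S * norm A / (1 + e)) \<le> exposure_time \<tau>1 s1 A"
  shows "MSP_admits punctured_plane 2 (\<lambda>i. [s0, s1] ! i) S"
proof -
  define \<tau> where "\<tau> i = [\<tau>0, \<tau>1] ! i" for i :: nat
  define C where "C = search_cost punctured_plane 2 (\<lambda>i. [s0, s1] ! i) \<tau>"
  have two: "{..<2::nat} = {0, 1}"
    by auto
  have pp: "A \<in> punctured_plane \<longleftrightarrow> A \<noteq> 0" for A
    by (auto simp: punctured_plane_def zero_prod_def)
  have min_eq: "(MIN i\<in>{..<2}. exposure_time (\<tau> i) ([s0, s1] ! i) A) =
        min (exposure_time \<tau>0 s0 A) (exposure_time \<tau>1 s1 A)" for A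
    by (simp add: two \<tau>_def)
  have "feasible punctured_plane 2 \<tau>"
    unfolding feasible_def
  proof safe
    fix i :: nat assume "i < 2"
    then show "search_curve (\<tau> i)"
      using assms(1,2) by (auto simp: less_2_cases_iff \<tau>_def)
  next
    fix a b assume "(a, b) \<in> punctured_plane"
    \<comment> \<open>Feasibility comes out of \<open>upper\<close>: a finite exposure time
      presupposes an exposing parameter.\<close>
    then have "exposure_time \<tau>0 s0 (a, b) \<noteq> \<infinity> \<or> exposure_time \<tau>1 s1 (a, b) \<noteq> \<infinity>"
      using upper[of "(a, b)"] by (auto simp: pp top_unique)
    then have "(\<exists>t. exposes (\<tau> 0 t) (a, b)) \<or> (\<exists>t. exposes (\<tau> 1 t) (a, b))"
      by (auto simp: exposure_time_def \<tau>_def split: if_splits)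
    then show "\<exists>i<2. \<exists>t. exposes (\<tau> i t) (a, b)"
      by (auto simp: less_2_cases_iff)
  qed
  moreover have "C = ennreal S"
  proof (rule antisym)
    show "C \<le> ennreal S"
      unfolding C_def search_cost_def min_eq
    proof (rule SUP_least)
      fix A assume "A \<in> punctured_plane"
      then have A: "A \<noteq> 0"
        by (simp add: pp)
      then have "min (exposure_time \<tau>0 s0 A) (exposure_time \<tau>1 s1 A) \<le> ennreal (S * norm A)"
        using upper by (auto simp: min_le_iff_disj)
      then have "ennreal (1 / norm A) * min (exposure_time \<tau>0 s0 A) (exposure_time \<tau>1 s1 A)
          \<le> ennreal (1 / norm A) * ennreal (S * norm A)"
        by (rule mult_left_mono) simp
      also have "\<dots> = ennreal S"
        using A assms(3) by (simp flip: ennreal_mult)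
      finally show "ennreal (1 / norm A) * min (exposure_time \<tau>0 s0 A) (exposure_time \<tau>1 s1 A) \<le> ennreal S" .
    qed
    have le: "ennreal (S / (1 + e)) \<le> C" if e: "e > 0" for e :: real
    proof -
      obtain A where A: "A \<noteq> 0" "ennreal (S * norm A / (1 + e)) \<le> exposure_time \<tau>0 s0 A"
          "ennreal (S * norm A / (1 + e)) \<le> exposure_time \<tau>1 s1 A"
        using lower[OF e] by blast
      have "ennreal (S / (1 + e)) = ennreal (1 / norm A) * ennreal (S * norm A / (1 + e))"
        using A(1) assms(3) e by (simp flip: ennreal_mult)
      also have "\<dots> \<le> ennreal (1 / norm A) * min (exposure_time \<tau>0 s0 A) (exposure_time \<tau>1 s1 A)"
        using A by (intro mult_left_mono) auto
      also have "\<dots> \<le> C"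
        unfolding C_def search_cost_def min_eq using A(1) by (intro SUP_upper) (simp add: pp)
      finally show ?thesis .
    qed
    have "((\<lambda>e. ennreal (S / (1 + e))) \<longlongrightarrow> ennreal (S / (1 + 0))) (at_right 0)"
      by (intro tendsto_intros tendsto_ennrealI) auto
    then have "((\<lambda>e. ennreal (S / (1 + e))) \<longlongrightarrow> ennreal S) (at_right 0)"
      by simp
    then show "ennreal S \<le> C"
      by (rule tendsto_upperbound) (auto simp: eventually_at_filter le)
  qed
  ultimately show ?thesis
    using assms(3) unfolding MSP_admits_def C_def by (intro exI[of _ \<tau>]) simp
qed

section \<open>Self-similar curves\<close>

definition glue :: "(int \<Rightarrow> real \<Rightarrow> 'a) \<Rightarrow> real \<Rightarrow> 'a" where
  "glue p t = p \<lfloor>t\<rfloor> t"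

lemma glue_eq:
  assumes "\<And>j. p j (of_int j + 1) = p (j + 1) (of_int j + 1)"
    and "of_int j \<le> t" "t \<le> of_int j + 1"
  shows "glue p t = p j t"
proof (cases "t = of_int j + 1")
  case True
  then have "\<lfloor>t\<rfloor> = j + 1"
    by simp
  with True assms(1)[of j] show ?thesis
    by (simp add: glue_def)
next
  case False
  with assms(2,3) have "\<lfloor>t\<rfloor> = j"
    by linarith
  then show ?thesis
    by (simp add: glue_def)
qed

lemma continuous_on_glue:
  fixes p :: "int \<Rightarrow> real \<Rightarrow> 'a::topological_space"
  assumes "\<And>j. p j (of_int j + 1) = p (j + 1) (of_int j + 1)"
    and "\<And>j. continuous_on UNIV (p j)"
  shows "continuous_on UNIV (glue p)"
  unfolding continuous_on_eq_continuous_at[OF open_UNIV]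
proof
  fix t :: real
  define j where "j = \<lfloor>t\<rfloor>"
  have *: "continuous_on {of_int i..of_int i + 1} (glue p)" for i
    using continuous_on_subset[OF assms(2)[of i]]
    by (rule continuous_on_eq) (auto simp: glue_eq[OF assms(1), of i])
  \<comment> \<open>Two neighbouring unit intervals are joined so that an integer \<open>t\<close>
    also has an open neighbourhood on which continuity is known.\<close>
  have "continuous_on ({of_int (j - 1)..of_int (j - 1) + 1} \<union> {of_int j..of_int j + 1}) (glue p)"
    by (intro continuous_on_closed_Un *) auto
  then have "continuous_on {of_int j - 1<..<of_int j + 1} (glue p)"
    by (rule continuous_on_subset) auto
  moreover have "t \<in> {of_int j - 1<..<of_int j + 1}"
    unfolding j_def by simp linarith
  ultimately show "isCont (glue p) t"
    by (auto simp: continuous_on_eq_continuous_at)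
qed

lemma glue_has_vector_derivative:
  assumes "u \<notin> \<int>" and "(p \<lfloor>u\<rfloor> has_vector_derivative d) (at u)"
  shows "(glue p has_vector_derivative d) (at u)"
proof (rule has_vector_derivative_transform_within_open[OF assms(2)])
  show "open {real_of_int \<lfloor>u\<rfloor><..<of_int \<lfloor>u\<rfloor> + 1}"
    by simp
  have "of_int \<lfloor>u\<rfloor> \<noteq> u"
    using assms(1) by (metis Ints_of_int)
  then have "of_int \<lfloor>u\<rfloor> < u"
    using of_int_floor_le[of u] by linarith
  then show "u \<in> {real_of_int \<lfloor>u\<rfloor><..<of_int \<lfloor>u\<rfloor> + 1}"
    by simp
  fix v assume "v \<in> {real_of_int \<lfloor>u\<rfloor><..<of_int \<lfloor>u\<rfloor> + 1}"
  then have "\<lfloor>v\<rfloor> = \<lfloor>u\<rfloor>"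
    by simp linarith
  then show "p \<lfloor>u\<rfloor> v = glue p v"
    by (simp add: glue_def)
qed

text \<open>\<open>div\<close> rounds down, so the pieces \<open>2 * i\<close> and
  \<open>2 * i + 1\<close> carry the same scale for negative \<open>i\<close> too.\<close>

definition pieces :: "real \<Rightarrow> (real \<Rightarrow> 'a::real_vector) \<Rightarrow> (real \<Rightarrow> 'a) \<Rightarrow> int \<Rightarrow> real \<Rightarrow> 'a" where
  "pieces E f g j t = (E powi (j div 2)) *\<^sub>R (if even j then f (t - of_int j) else g (t - of_int j))"

text \<open>One round takes two units of the parameter: it runs through \<^term>\<open>f\<close> and then \<^term>\<open>g\<close>, both on
  the unit interval, and the next round repeats it scaled by \<^term>\<open>E\<close>.\<close>

definition self_similar :: "real \<Rightarrow> (real \<Rightarrow> 'a::real_vector) \<Rightarrow> (real \<Rightarrow> 'a) \<Rightarrow> real \<Rightarrow> 'a" where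
  "self_similar E f g = glue (pieces E f g)"

lemma pieces_match:
  assumes "f 1 = g 0" "g 1 = E *\<^sub>R f 0" "E > 0"
  shows "pieces E f g j (of_int j + 1) = pieces E f g (j + 1) (of_int j + 1)"
proof (cases "even j")
  case True
  then show ?thesis
    using assms by (auto simp: pieces_def elim!: evenE)
next
  case False
  then obtain i where "j = 2 * i + 1"
    by (rule oddE)
  moreover have "(2 * i + 1 + 1) div 2 = i + 1" "(2 * i + 1) div 2 = i"
    by presburger+
  ultimately show ?thesis
    using assms by (simp add: pieces_def power_int_add mult.commute)
qed

lemma continuous_on_self_similar:
  fixes f :: "real \<Rightarrow> 'a::real_normed_vector"
  assumes "f 1 = g 0" "g 1 = E *\<^sub>R f 0" "E > 0"
    and "continuous_on UNIV f" "continuous_on UNIV g"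
  shows "continuous_on UNIV (self_similar E f g)"
  unfolding self_similar_def
proof (rule continuous_on_glue)
  have "continuous_on UNIV (\<lambda>t. f (t - of_int j))" "continuous_on UNIV (\<lambda>t. g (t - of_int j))" for j
    by (auto intro!: continuous_on_compose2[OF assms(4)] continuous_on_compose2[OF assms(5)] continuous_intros)
  then show "continuous_on UNIV (pieces E f g j)" for j
    unfolding pieces_def by (cases "even j") (auto intro!: continuous_intros)
qed (rule pieces_match[OF assms(1-3)])

text \<open>The round index at parameter \<open>t\<close> is at most \<open>t / 2\<close>, so the
  curve is dominated by \<open>E powr (t / 2)\<close> times a bound for a single round.\<close>

lemma self_similar_tendsto_0:
  fixes f :: "real \<Rightarrow> 'a::real_normed_vector"
  assumes "E > 1" "continuous_on UNIV f" "continuous_on UNIV g"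
  shows "(self_similar E f g \<longlongrightarrow> 0) at_bot"
proof -
  have "compact (f ` {0..1} \<union> g ` {0..1})"
    by (intro compact_Un compact_continuous_image continuous_on_subset[OF assms(2)]
        continuous_on_subset[OF assms(3)]) auto
  then obtain B where B: "\<And>s. s \<in> {0..1} \<Longrightarrow> norm (f s) \<le> B" "\<And>s. s \<in> {0..1} \<Longrightarrow> norm (g s) \<le> B"
    using compact_imp_bounded bounded_iff by (metis UnCI imageI)
  have bound: "norm (self_similar E f g t) \<le> E powr (t / 2) * B" for t
  proof -
    define j where "j = \<lfloor>t\<rfloor>"
    have "t - of_int j \<in> {0..1}"
      unfolding j_def by simp linarith
    then have B': "norm (if even j then f (t - of_int j) else g (t - of_int j)) \<le> B"
      using B by simp
    have "2 * (j div 2) \<le> j"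
      by presburger
    then have "real_of_int (2 * (j div 2)) \<le> of_int j"
      by (simp only: of_int_le_iff)
    then have "real_of_int (j div 2) \<le> t / 2"
      unfolding j_def by simp linarith
    then have "E powi (j div 2) \<le> E powr (t / 2)"
      using assms(1) by (simp flip: powr_real_of_int')
    then have "norm (pieces E f g j t) \<le> E powr (t / 2) * B"
      unfolding pieces_def norm_scaleR using B' assms(1) by (intro mult_mono) auto
    then show ?thesis
      by (simp add: self_similar_def glue_def j_def)
  qed
  have "filterlim (\<lambda>t. (ln E / 2) * t) at_bot at_bot"
    using assms(1) by (intro filterlim_tendsto_pos_mult_at_bot[OF tendsto_const] filterlim_ident) auto
  then have "((\<lambda>t. exp ((ln E / 2) * t)) \<longlongrightarrow> 0) at_bot"
    by (rule filterlim_compose[OF exp_at_bot])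
  moreover have "exp ((ln E / 2) * t) = E powr (t / 2)" for t
    using assms(1) by (simp add: powr_def)
  ultimately have "((\<lambda>t. E powr (t / 2) * B) \<longlongrightarrow> 0) at_bot"
    by (intro tendsto_mult_left_zero) simp
  then show ?thesis
    by (rule Lim_null_comparison[OF always_eventually, rotated]) (rule allI, rule bound)
qed

lemma self_similar_at:
  assumes "f 1 = g 0" "g 1 = E *\<^sub>R f 0" "E > 0" "s \<in> {0..1}"
  shows "self_similar E f g (2 * of_int n + s) = E powi n *\<^sub>R f s"
    and "self_similar E f g (2 * of_int n + 1 + s) = E powi n *\<^sub>R g s"
proof -
  have "glue (pieces E f g) (2 * of_int n + s) = pieces E f g (2 * n) (2 * of_int n + s)"
    "glue (pieces E f g) (2 * of_int n + 1 + s) = pieces E f g (2 * n + 1) (2 * of_int n + 1 + s)"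
    using assms(4) by (auto intro!: glue_eq pieces_match assms)
  then show "self_similar E f g (2 * of_int n + s) = E powi n *\<^sub>R f s"
    "self_similar E f g (2 * of_int n + 1 + s) = E powi n *\<^sub>R g s"
    by (simp_all add: self_similar_def pieces_def)
qed

lemma self_similar_cases:
  obtains (fst) n s where "0 \<le> s" "s < 1" "t = 2 * of_int n + s"
  | (snd) n s where "0 \<le> s" "s < 1" "t = 2 * of_int n + 1 + (s::real)"
proof (cases "even \<lfloor>t\<rfloor>")
  case True
  then obtain n where "\<lfloor>t\<rfloor> = 2 * n"
    by (rule evenE)
  then show ?thesis
    by (intro fst[of "t - 2 * of_int n" n]) linarith+
next
  case False
  then obtain n where "\<lfloor>t\<rfloor> = 2 * n + 1"
    by (rule oddE)
  then show ?thesis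
    by (intro snd[of "t - (2 * of_int n + 1)" n]) linarith+
qed

lemma finite_Ints_interval: "finite ({a..b} \<inter> (\<int> :: real set))"
proof -
  have "{a..b} \<inter> \<int> \<subseteq> of_int ` {\<lfloor>a\<rfloor>..\<lceil>b\<rceil>}"
    by (force simp: Ints_def floor_le_iff le_ceiling_iff)
  then show ?thesis
    using finite_subset by blast
qed

text \<open>\<open>l\<close> and \<open>m\<close> are antiderivatives of the speed that obey the
  same matching rules as \<open>f\<close> and \<open>g\<close>. The rule
  \<open>m 1 = E * l 0\<close> fixes the constant of integration: it makes \<open>l 0\<close> the
  geometric sum of the lengths of all earlier rounds, so the total length is self-similar as
  well.\<close>

locale self_similar_curve =
  fixes E :: real and f g f' g' :: "real \<Rightarrow> real \<times> real" and l m :: "real \<Rightarrow> real"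
  assumes E: "E > 1"
    and f: "(f has_vector_derivative f' s) (at s)" and g: "(g has_vector_derivative g' s) (at s)"
    and fg: "f 1 = g 0" "g 1 = E *\<^sub>R f 0"
    and l: "(l has_real_derivative norm (f' s)) (at s)" and m: "(m has_real_derivative norm (g' s)) (at s)"
    and lm: "l 1 = m 0" "m 1 = E * l 0"
begin

lemma pieces_has_vector_derivative:
  "(pieces E f g j has_vector_derivative pieces E f' g' j t) (at t)"
  "(pieces E l m j has_real_derivative norm (pieces E f' g' j t)) (at t)"
proof -
  have shift: "((\<lambda>t. t - of_int j) has_real_derivative 1) (at t)"
    by (auto intro!: derivative_eq_intros)
  have "((\<lambda>t. f (t - of_int j)) has_vector_derivative f' (t - of_int j)) (at t)"
    "((\<lambda>t. g (t - of_int j)) has_vector_derivative g' (t - of_int j)) (at t)"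
    using vector_diff_chain_at[OF shift[unfolded has_real_derivative_iff_has_vector_derivative] f]
      vector_diff_chain_at[OF shift[unfolded has_real_derivative_iff_has_vector_derivative] g]
    by (simp_all add: o_def)
  then have "((\<lambda>t. c *\<^sub>R f (t - of_int j)) has_vector_derivative c *\<^sub>R f' (t - of_int j)) (at t)"
    "((\<lambda>t. c *\<^sub>R g (t - of_int j)) has_vector_derivative c *\<^sub>R g' (t - of_int j)) (at t)" for c
    by (auto intro: bounded_linear.has_vector_derivative[OF bounded_linear_scaleR_right])
  then show "(pieces E f g j has_vector_derivative pieces E f' g' j t) (at t)"
    unfolding pieces_def by (cases "even j") simp_all
  have "((\<lambda>t. l (t - of_int j)) has_real_derivative norm (f' (t - of_int j))) (at t)"
    "((\<lambda>t. m (t - of_int j)) has_real_derivative norm (g' (t - of_int j))) (at t)"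
    using DERIV_chain'[OF shift l] DERIV_chain'[OF shift m] by simp_all
  then show "(pieces E l m j has_real_derivative norm (pieces E f' g' j t)) (at t)"
    unfolding pieces_def norm_scaleR using E
    by (cases "even j") (simp_all add: DERIV_cmult)
qed

lemma cont: "continuous_on UNIV f" "continuous_on UNIV g" "continuous_on UNIV l" "continuous_on UNIV m"
  using f g l m
  by (auto simp: continuous_on_eq_continuous_at
      intro!: has_vector_derivative_continuous DERIV_isCont)

lemma search_curve: "search_curve (self_similar E f g)"
proof -
  have c: "continuous_on UNIV (self_similar E f g)"
    using fg E by (intro continuous_on_self_similar cont) auto
  moreover have "self_similar E f g piecewise_differentiable_on {a..b}" for a b
    unfolding piecewise_differentiable_on_def
  proof (intro conjI exI[of _ "{a..b} \<inter> \<int>"] finite_Ints_interval ballI)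
    fix u assume "u \<in> {a..b} - {a..b} \<inter> \<int>"
    then have "u \<notin> \<int>"
      by blast
    then have "(self_similar E f g has_vector_derivative pieces E f' g' \<lfloor>u\<rfloor> u) (at u)"
      unfolding self_similar_def
      by (rule glue_has_vector_derivative[OF _ pieces_has_vector_derivative(1)])
    then show "self_similar E f g differentiable at u within {a..b}"
      by (rule differentiable_at_withinI[OF differentiableI_vector])
  qed (rule continuous_on_subset[OF c], simp)
  moreover have "(self_similar E f g \<longlongrightarrow> 0) at_bot"
    using E by (intro self_similar_tendsto_0 cont)
  ultimately show ?thesis
    by (simp add: search_curve_def zero_prod_def)
qed

lemma len_upto: "len_upto (self_similar E f g) t = ennreal (self_similar E l m t)"
proof (rule len_upto_eqI)
  show "continuous_on UNIV (self_similar E l m)"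
    using lm E by (intro continuous_on_self_similar cont) auto
  show "(self_similar E l m \<longlongrightarrow> 0) at_bot"
    using E by (intro self_similar_tendsto_0 cont)
  show "finite ({a..b} \<inter> \<int>)" for a b :: real
    by (rule finite_Ints_interval)
  fix u :: real assume u: "u \<notin> \<int>"
  have "vector_derivative (self_similar E f g) (at u) = pieces E f' g' \<lfloor>u\<rfloor> u"
    unfolding self_similar_def
    by (intro vector_derivative_at glue_has_vector_derivative u pieces_has_vector_derivative)
  moreover have "(self_similar E l m has_vector_derivative norm (pieces E f' g' \<lfloor>u\<rfloor> u)) (at u)"
    unfolding self_similar_def
    by (intro glue_has_vector_derivative u pieces_has_vector_derivative
        [unfolded has_real_derivative_iff_has_vector_derivative])
  ultimately show "(self_similar E l m has_real_derivative
      norm (vector_derivative (self_similar E f g) (at u))) (at u)"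
    by (simp add: has_real_derivative_iff_has_vector_derivative)
qed

end

section \<open>The optimal values\<close>

text \<open>Each bound forces large values at one end of the domain, so only a compact set can
  compete with the trial value \<open>f 2\<close>.\<close>

lemma attains_min_greaterThan_1:
  fixes f :: "real \<Rightarrow> real"
  assumes "continuous_on {1<..} f" "a > 0" "b > 0"
    and bounds: "\<And>x. x > 1 \<Longrightarrow> a / (x - 1) \<le> f x" "\<And>x. x > 1 \<Longrightarrow> b * x \<le> f x"
  obtains x where "x > 1" "\<And>y. y > 1 \<Longrightarrow> f x \<le> f y"
proof -
  define M where "M = f 2"
  define K where "K = {1 + a / M..M / b}"
  have M: "a \<le> M" "b * 2 \<le> M"
    using bounds[of 2] by (auto simp: M_def)
  then have "M > 0"
    using assms(2) by simp
  have K: "K \<subseteq> {1<..}"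
    using \<open>M > 0\<close> assms(2) by (auto simp: K_def add_pos_pos intro: less_le_trans[of _ "1 + a / M"])
  have 2: "2 \<in> K"
    using M \<open>M > 0\<close> assms(3) by (simp add: K_def field_simps)
  have "compact K"
    by (simp add: K_def)
  then obtain x where x: "x \<in> K" "\<And>y. y \<in> K \<Longrightarrow> f x \<le> f y"
    using continuous_attains_inf[of K f] continuous_on_subset[OF assms(1) K] 2 by blast
  have "f x \<le> f y" if "y > 1" for y
  proof (cases "y \<in> K")
    case False
    then consider "y < 1 + a / M" | "y > M / b"
      by (auto simp: K_def not_le)
    then have "M < f y"
    proof cases
      case 1
      then have "M < a / (y - 1)"
        using that \<open>M > 0\<close> by (simp add: field_simps)
      then show ?thesis
        using bounds(1)[OF that] by simp
    next
      case 2
      then have "M < b * y"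
        using assms(3) by (simp add: field_simps)
      then show ?thesis
        using bounds(2)[OF that] by simp
    qed
    then show ?thesis
      using x(2)[OF 2] by (simp add: M_def)
  qed (rule x(2))
  with x(1) K that show thesis
    by blast
qed

text \<open>The square is the growth of the first coordinate between two visits of the zigzag to the
  same side of the wedge, the root its length per unit of that coordinate. Divided by
  \<open>sqrt (1 + h\<^sup>2)\<close>, the product is the length per radius for a point just missed
  on a side.\<close>

definition zigzag_cost :: "real \<Rightarrow> real \<Rightarrow> real" where
  "zigzag_cost h w = ((w + 1) / (w - 1))\<^sup>2 * sqrt (1 + h\<^sup>2 * w\<^sup>2)"

text \<open>For \<open>w = tan b / tan a\<close>, both \<open>w + 1\<close> and \<open>w - 1\<close>
  are the sine of a sum or difference over \<open>cos b * sin a\<close>, and the root is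
  \<open>1 / cos b\<close>. It is used with \<open>a = \<phi> / 2\<close> and
  \<open>b = \<theta> - \<phi> / 2\<close>.\<close>

lemma zigzag_cost_tan:
  assumes "0 < a" "a < b" "b < pi / 2"
  shows "(sin (b + a) / sin (b - a))\<^sup>2 * (1 / cos b) = zigzag_cost (tan a) (tan b / tan a)"
proof -
  have pos: "cos a > 0" "cos b > 0" "sin a > 0" "sin (b - a) > 0"
    using assms by (auto intro!: cos_gt_zero_pi sin_gt_zero)
  have "tan b / tan a - 1 = sin (b - a) / (cos b * sin a)"
    "tan b / tan a + 1 = sin (b + a) / (cos b * sin a)"
    using pos by (simp_all add: tan_def sin_diff sin_add field_simps)
  moreover have "sqrt (1 + (tan b)\<^sup>2) = 1 / cos b"
    using pos tan_sec[of b] by (simp add: real_sqrt_divide inverse_eq_divide real_sqrt_unique)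
  moreover have "tan a > 0"
    using pos by (simp add: tan_def)
  then have "(tan a)\<^sup>2 * (tan b / tan a)\<^sup>2 = (tan b)\<^sup>2"
    by (simp add: power_divide)
  ultimately show ?thesis
    using pos by (simp add: zigzag_cost_def power_divide)
qed

text \<open>\<open>LEAST\<close> denotes the minimum only when it is attained, which follows from
  lower bounds at both ends of the domain. The minimality of \<open>w\<close> is exported for a
  first-order condition.\<close>

lemma F_min_eq:
  assumes "0 < \<phi>" "\<phi> < pi"
  obtains w where "w > 1" "F_min \<phi> = zigzag_cost (tan (\<phi> / 2)) w"
    "\<And>v. v > 1 \<Longrightarrow> zigzag_cost (tan (\<phi> / 2)) w \<le> zigzag_cost (tan (\<phi> / 2)) v"
proof -
  define h where "h = tan (\<phi> / 2)"
  have h: "h > 0"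
    using assms unfolding h_def by (intro tan_gt_zero) auto
  have "continuous_on {1<..} (zigzag_cost h)"
    unfolding zigzag_cost_def by (intro continuous_intros) auto
  moreover have ge: "1 / (x - 1) \<le> zigzag_cost h x" "h * x \<le> zigzag_cost h x" if "x > 1" for x
  proof -
    have r: "1 \<le> (x + 1) / (x - 1)" "1 / (x - 1) \<le> (x + 1) / (x - 1)"
      using that by (auto simp: divide_right_mono)
    then have r2: "(x + 1) / (x - 1) \<le> ((x + 1) / (x - 1))\<^sup>2"
      by (intro self_le_power) auto
    have s: "1 \<le> sqrt (1 + h\<^sup>2 * x\<^sup>2)"
      by simp
    have s': "h * x \<le> sqrt (1 + h\<^sup>2 * x\<^sup>2)"
      by (rule real_le_rsqrt) (simp add: power_mult_distrib)
    have "1 / (x - 1) * 1 \<le> zigzag_cost h x"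
      unfolding zigzag_cost_def using r r2 s that by (intro mult_mono) auto
    then show "1 / (x - 1) \<le> zigzag_cost h x"
      by simp
    have "1 * (h * x) \<le> zigzag_cost h x"
      unfolding zigzag_cost_def using r r2 s' that h by (intro mult_mono) auto
    then show "h * x \<le> zigzag_cost h x"
      by simp
  qed
  ultimately obtain w where w: "w > 1" "\<And>v. v > 1 \<Longrightarrow> zigzag_cost h w \<le> zigzag_cost h v"
    using attains_min_greaterThan_1[of "zigzag_cost h" 1 h] h by auto
  let ?F = "\<lambda>\<theta>. (sin \<theta> / sin (\<theta> - \<phi>))\<^sup>2 * (1 / cos (\<theta> - \<phi> / 2))"
  have F: "?F \<theta> = zigzag_cost h (tan (\<theta> - \<phi> / 2) / h)" if "\<theta> \<in> {\<phi><..<pi / 2 + \<phi> / 2}" for \<theta>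
    using zigzag_cost_tan[of "\<phi> / 2" "\<theta> - \<phi> / 2"] that assms by (simp add: h_def)
  have "F_min \<phi> = zigzag_cost h w"
    unfolding F_min_def
  proof (rule Least_equality)
    let ?\<theta> = "\<phi> / 2 + arctan (h * w)"
    have "\<phi> / 2 = arctan h"
      unfolding h_def using assms by (intro arctan_unique[symmetric]) auto
    also have "\<dots> < arctan (h * w)"
      using h w(1) by (simp add: arctan_less_iff)
    finally have \<theta>: "?\<theta> \<in> {\<phi><..<pi / 2 + \<phi> / 2}"
      using arctan_ubound[of "h * w"] by simp
    moreover have "zigzag_cost h w = ?F ?\<theta>"
      unfolding F[OF \<theta>] using h by (simp add: tan_arctan)
    ultimately show "zigzag_cost h w \<in> ?F ` {\<phi><..<pi / 2 + \<phi> / 2}"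
      by (rule rev_image_eqI)
  next
    fix v assume "v \<in> ?F ` {\<phi><..<pi / 2 + \<phi> / 2}"
    then obtain \<theta> where \<theta>: "\<theta> \<in> {\<phi><..<pi / 2 + \<phi> / 2}" "v = ?F \<theta>"
      by blast
    have "tan (\<phi> / 2) < tan (\<theta> - \<phi> / 2)"
      using \<theta>(1) assms by (intro tan_monotone) auto
    then have "tan (\<theta> - \<phi> / 2) / h > 1"
      using h by (simp add: h_def)
    then show "zigzag_cost h w \<le> v"
      unfolding \<theta>(2) F[OF \<theta>(1)] by (rule w(2))
  qed
  with w that show thesis
    unfolding h_def by blast
qed

section \<open>The objective of the cut spiral\<close>

definition spiral_rate :: "real \<Rightarrow> real \<Rightarrow> real" where
  "spiral_rate \<phi> l = (l - 1) / sqrt (2 * l * (1 - cos \<phi>))"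

text \<open>The growth over one round: a factor \<open>l\<close> across the chord and the
  exponential factor along the spiral, which turns through the angle
  \<open>2 * pi - \<phi>\<close>.\<close>

lemma exp_k_exp:
  assumes "l > 1"
  shows "exp (2 * pi * k_exp \<phi> l) = l * exp ((2 * pi - \<phi>) * spiral_rate \<phi> l)"
proof -
  have "2 * pi * k_exp \<phi> l = ln l + (2 * pi - \<phi>) * spiral_rate \<phi> l"
    by (simp add: k_exp_def spiral_rate_def distrib_left)
      (simp add: field_simps)
  then show ?thesis
    using assms by (simp add: exp_add)
qed

text \<open>By the law of cosines the left side is the length of a chord between radii 1 and
  \<open>l\<close> at angle \<open>\<phi>\<close>, per unit of radius gained. The right side is the
  length per radius of a logarithmic spiral. Their equality is what singles out
  \<open>spiral_rate\<close>.\<close>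

lemma chord_ratio:
  assumes "0 < \<phi>" "\<phi> < pi" "l > 1"
  shows "spiral_rate \<phi> l > 0"
    and "sqrt (l\<^sup>2 - 2 * l * cos \<phi> + 1) / (l - 1) = sqrt (1 + 1 / (spiral_rate \<phi> l)\<^sup>2)"
proof -
  have c: "1 - cos \<phi> > 0"
    using cos_monotone_0_pi[of 0 \<phi>] assms by simp
  then show "spiral_rate \<phi> l > 0"
    using assms by (simp add: spiral_rate_def)
  have "1 + 1 / (spiral_rate \<phi> l)\<^sup>2 = ((l - 1)\<^sup>2 + 2 * l * (1 - cos \<phi>)) / (l - 1)\<^sup>2"
    using assms c by (simp add: spiral_rate_def power_divide add_divide_distrib)
  also have "(l - 1)\<^sup>2 + 2 * l * (1 - cos \<phi>) = l\<^sup>2 - 2 * l * cos \<phi> + 1"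
    by (simp add: power2_eq_square algebra_simps)
  finally show "sqrt (l\<^sup>2 - 2 * l * cos \<phi> + 1) / (l - 1) = sqrt (1 + 1 / (spiral_rate \<phi> l)\<^sup>2)"
    using assms by (simp add: real_sqrt_divide)
qed

lemma R_min_eq:
  assumes "0 < \<phi>" "\<phi> < pi"
  obtains l where "l > 1" "R_min \<phi> = sqrt (l\<^sup>2 - 2 * l * cos \<phi> + 1) / (l - 1) *
      (l * exp ((2 * pi - \<phi>) * spiral_rate \<phi> l))"
proof -
  let ?V = "\<lambda>l. sqrt (l\<^sup>2 - 2 * l * cos \<phi> + 1) / (l - 1) * exp (2 * pi * k_exp \<phi> l)"
  have c: "1 - cos \<phi> > 0"
    using cos_monotone_0_pi[of 0 \<phi>] assms by simp
  have s: "sin \<phi> > 0"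
    using assms by (simp add: sin_gt_zero)
  have "continuous_on {1<..} ?V"
    unfolding k_exp_def using c by (intro continuous_intros) auto
  moreover have "sin \<phi> / (l - 1) \<le> ?V l" "1 * l \<le> ?V l" if "l > 1" for l
  proof -
    have e: "l \<le> exp (2 * pi * k_exp \<phi> l)"
      unfolding exp_k_exp[OF that] using that assms chord_ratio(1)[OF assms that] by simp
    \<comment> \<open>The right side is
      \<open>(l - cos \<phi>)\<^sup>2 + (sin \<phi>)\<^sup>2\<close>.\<close>
    have "(sin \<phi>)\<^sup>2 \<le> l\<^sup>2 - 2 * l * cos \<phi> + 1"
      using zero_le_power2[of "l - cos \<phi>"] unfolding sin_squared_eq power2_diff by linarith
    then have "sin \<phi> \<le> sqrt (l\<^sup>2 - 2 * l * cos \<phi> + 1)"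
      by (rule real_le_rsqrt)
    then have "sin \<phi> / (l - 1) * 1 \<le> ?V l"
      using that e s by (intro mult_mono divide_right_mono divide_nonneg_nonneg) linarith+
    then show "sin \<phi> / (l - 1) \<le> ?V l"
      by simp
    have "1 \<le> sqrt (l\<^sup>2 - 2 * l * cos \<phi> + 1) / (l - 1)"
      unfolding chord_ratio(2)[OF assms that] by simp
    then show "1 * l \<le> ?V l"
      using that e by (intro mult_mono) linarith+
  qed
  ultimately obtain l where l: "l > 1" "\<And>y. y > 1 \<Longrightarrow> ?V l \<le> ?V y"
    using attains_min_greaterThan_1[of ?V "sin \<phi>" 1] s by auto
  have "R_min \<phi> = ?V l"
    unfolding R_min_def
  proof (rule Least_equality)
    show "?V l \<in> ?V ` {1<..}"
      using l(1) by (intro imageI) simp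
    fix y assume "y \<in> ?V ` {1<..}"
    then obtain v where "v > 1" "y = ?V v"
      by auto
    then show "?V l \<le> y"
      using l(2) by simp
  qed
  then show thesis
    using that[OF l(1)] l(1) by (simp only: exp_k_exp)
qed

text \<open>The difficulty is uniformity in \<open>\<phi>\<close>: for fixed \<open>k\<close> the
  growth across the chord disappears as \<open>\<phi>\<close> shrinks. Write
  \<open>2 * pi - \<phi> = pi + 2 * v\<close>. The chord contributes at least
  \<open>1 + 2 * y + 2 * y\<^sup>2\<close> with \<open>y = k * sin (\<phi> / 2)\<close>, the angle
  \<open>2 * v\<close> at least the same polynomial in \<open>z = k * v\<close>, and
  \<open>sin (\<phi> / 2) + v \<ge> 1\<close> lets one make up for the other. The remaining half
  turn and \<open>sqrt (1 + 1 / k\<^sup>2) \<ge> 1 / k\<close> then give a bound in \<open>k\<close>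
  alone.\<close>

lemma R_min_ge_12:
  assumes "0 < \<phi>" "\<phi> < pi"
  shows "12 \<le> R_min \<phi>"
proof -
  obtain l where l: "l > 1" and R: "R_min \<phi> = sqrt (l\<^sup>2 - 2 * l * cos \<phi> + 1) / (l - 1) *
      (l * exp ((2 * pi - \<phi>) * spiral_rate \<phi> l))"
    using R_min_eq[OF assms] by blast
  define k where "k = spiral_rate \<phi> l"
  define s where "s = sin (\<phi> / 2)"
  define v where "v = pi / 2 - \<phi> / 2"
  define y where "y = k * s"
  define r where "r = sqrt l"
  have k: "k > 0"
    using chord_ratio(1)[OF assms l] by (simp add: k_def)
  have s: "s > 0"
    unfolding s_def using assms by (intro sin_gt_zero) auto
  have v: "0 \<le> v" "v \<le> 2"
    using assms pi_less_4 by (auto simp: v_def)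
  have r: "r > 0" "r\<^sup>2 = l"
    using l by (auto simp: r_def)
  have y: "y \<ge> 0"
    using k s by (simp add: y_def)
  have "1 - cos \<phi> = 2 * s\<^sup>2"
    using cos_double_sin[of "\<phi> / 2"] by (simp add: s_def)
  then have "sqrt (2 * l * (1 - cos \<phi>)) = sqrt (2 * r\<^sup>2 * (2 * s\<^sup>2))"
    by (simp only: r(2))
  also have "\<dots> = sqrt ((2 * r * s)\<^sup>2)"
    by (simp add: power_mult_distrib)
  also have "\<dots> = 2 * r * s"
    using r s by simp
  finally have "k * (2 * r * s) = l - 1"
    using r s by (simp add: k_def spiral_rate_def)
  then have r_eq: "r\<^sup>2 - 2 * y * r = 1"
    using r(2) by (simp add: y_def algebra_simps)
  \<comment> \<open>Excludes the negative root of
    \<open>(r - y)\<^sup>2 = 1 + y\<^sup>2\<close>.\<close>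
  have "r \<ge> y"
  proof (rule ccontr)
    assume "\<not> y \<le> r"
    then have "r * (r - 2 * y) \<le> 0"
      using r(1) y by (intro mult_nonneg_nonpos) auto
    with r_eq show False
      by (simp add: power2_eq_square algebra_simps)
  qed
  moreover have "1\<^sup>2 \<le> (r - y)\<^sup>2"
    using r_eq by (simp add: power2_diff algebra_simps)
  ultimately have "1 + y \<le> r"
    using power2_le_imp_le[of 1 "r - y"] by simp
  then have "y * (1 + y) \<le> y * r"
    using y by (rule mult_left_mono)
  then have l_ge: "1 + 2 * y + 2 * y\<^sup>2 \<le> l"
    using r_eq r(2) by (simp add: power2_eq_square algebra_simps)
  \<comment> \<open>From \<open>cos v = 1 - 2 * (sin (v / 2))\<^sup>2\<close> and
    \<open>sin x \<le> x\<close>.\<close>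
  have "1 - v\<^sup>2 / 2 \<le> cos v"
    using cos_double_sin[of "v / 2"] power_mono[OF sin_x_le_x[of "v / 2"], of 2] v sin_ge_zero[of "v / 2"] pi_gt3
    by (simp add: power_divide)
  moreover have "v\<^sup>2 / 2 \<le> v"
    using mult_left_mono[OF v(2,1)] by (simp add: power2_eq_square)
  moreover have "cos v = s"
    by (simp add: v_def s_def sin_cos_eq)
  ultimately have "1 \<le> s + v"
    by simp
  then have kz: "k \<le> y + k * v"
    using k mult_left_mono[of 1 "s + v" k] by (simp add: y_def algebra_simps)
  define z where "z = k * v"
  have z: "z \<ge> 0"
    using k v by (simp add: z_def)
  have "1 + pi * k + (pi * k)\<^sup>2 / 2 \<le> exp (pi * k)"
    using k by (intro exp_lower_Taylor_quadratic) auto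
  moreover have "3 * k \<le> pi * k"
    using k pi_gt3 by (intro mult_right_mono) auto
  moreover from this have "(3 * k)\<^sup>2 \<le> (pi * k)\<^sup>2"
    using k by (intro power_mono) auto
  ultimately have e1: "1 + 3 * k + 9 / 2 * k\<^sup>2 \<le> exp (pi * k)"
    by (simp add: power_mult_distrib)
  have e2: "1 + 2 * z + 2 * z\<^sup>2 \<le> exp (2 * z)"
    using exp_lower_Taylor_quadratic[of "2 * z"] z by (simp add: power_mult_distrib)
  have "1 + 2 * k + 2 * k\<^sup>2 \<le> 1 + 2 * (y + z) + 2 * (y + z)\<^sup>2"
    using kz k by (intro add_mono mult_left_mono power_mono) (auto simp: z_def)
  also have "\<dots> \<le> (1 + 2 * y + 2 * y\<^sup>2) * (1 + 2 * z + 2 * z\<^sup>2)"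
  proof -
    have "0 \<le> 4 * y * z\<^sup>2 + 4 * y\<^sup>2 * z + 4 * y\<^sup>2 * z\<^sup>2"
      using y z by simp
    then show ?thesis
      by (simp add: power2_eq_square algebra_simps)
  qed
  also have "\<dots> \<le> l * exp (2 * z)"
    using l_ge e2 l y z by (intro mult_mono) auto
  finally have "(1 + 2 * k + 2 * k\<^sup>2) * (1 + 3 * k + 9 / 2 * k\<^sup>2) \<le> (l * exp (2 * z)) * exp (pi * k)"
    using e1 k l by (intro mult_mono) auto
  also have "\<dots> = l * exp ((2 * pi - \<phi>) * k)"
    by (simp add: z_def v_def mult.assoc algebra_simps flip: exp_add)
  finally have *: "(1 + 2 * k + 2 * k\<^sup>2) * (1 + 3 * k + 9 / 2 * k\<^sup>2) \<le> l * exp ((2 * pi - \<phi>) * k)" .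
  \<comment> \<open>After subtraction of \<open>12 * k\<close> the part of degree at most two is
    \<open>1 - 7 * k + 25 / 2 * k\<^sup>2\<close>, whose discriminant is -1.\<close>
  have "12 * k \<le> (1 + 2 * k + 2 * k\<^sup>2) * (1 + 3 * k + 9 / 2 * k\<^sup>2)"
  proof -
    have "(1 + 2 * k + 2 * k\<^sup>2) * (1 + 3 * k + 9 / 2 * k\<^sup>2) - 12 * k =
      (1 - 7 / 2 * k)\<^sup>2 + 1 / 4 * k\<^sup>2 + 15 * k ^ 3 + 9 * k ^ 4"
      by (simp add: power2_eq_square power3_eq_cube power4_eq_xxxx algebra_simps)
    also have "\<dots> \<ge> 0"
      using k by simp
    finally show ?thesis
      by simp
  qed
  with * have "12 \<le> 1 / k * (l * exp ((2 * pi - \<phi>) * k))"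
    using k by (simp add: field_simps)
  also have "\<dots> \<le> sqrt (1 + 1 / k\<^sup>2) * (l * exp ((2 * pi - \<phi>) * k))"
    using l by (intro mult_right_mono real_le_rsqrt) (auto simp: power_divide)
  also have "\<dots> = R_min \<phi>"
    unfolding R k_def chord_ratio(2)[OF assms l] ..
  finally show ?thesis .
qed

section \<open>Estimates for the two regimes of \<open>h\<close>\<close>

lemma zigzag_cost_ge:
  assumes "3 / 4 \<le> h" "w > 1"
  shows "34 / 5 \<le> zigzag_cost h w / sqrt (1 + h\<^sup>2)"
proof -
  define u where "u = w - 1"
  have u: "u > 0"
    using assms by (simp add: u_def)
  have h: "(3 / 4)\<^sup>2 \<le> h\<^sup>2"
    using assms by (intro power_mono) auto
  \<comment> \<open>The linear function is the tangent at \<open>w = 32 / 7\<close> to the root for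
    \<open>h = 3 / 4\<close>. That point is close to the minimizer for this \<open>h\<close> and
    makes the root rational.\<close>
  have "((28 + 72 * w) / 125)\<^sup>2 \<le> (16 + 9 * w\<^sup>2) / 25"
    using zero_le_power2[of "96 - 21 * w"] by (simp add: power2_eq_square field_simps)
  also have "\<dots> \<le> (1 + h\<^sup>2 * w\<^sup>2) / (1 + h\<^sup>2)"
  proof -
    \<comment> \<open>As \<open>w > 1\<close>, the quotient increases with \<open>h\<close>, so
      \<open>h = 3 / 4\<close> is the worst case.\<close>
    have "0 \<le> (16 * h\<^sup>2 - 9) * (w\<^sup>2 - 1)"
      using h one_le_power[of w 2] assms(2)
      by (intro mult_nonneg_nonneg) (auto simp: power2_eq_square)
    then show ?thesis
      by (simp add: field_simps add_pos_nonneg)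
  qed
  finally have C: "(28 + 72 * w) / 125 \<le> sqrt (1 + h\<^sup>2 * w\<^sup>2) / sqrt (1 + h\<^sup>2)"
    unfolding real_sqrt_divide[symmetric] by (rule real_le_rsqrt)
  \<comment> \<open>With denominators cleared the claim is a cubic inequality; the square is centred
    near the minimum of the cubic.\<close>
  have "(u + 2)\<^sup>2 * (100 + 72 * u) - 850 * u\<^sup>2 = (u - 10 / 3)\<^sup>2 * (72 * u + 18) + 8 * u + 200"
    by (simp add: power2_eq_square algebra_simps)
  also have "\<dots> \<ge> 0"
    using u by simp
  finally have "34 / 5 \<le> ((w + 1) / (w - 1))\<^sup>2 * ((28 + 72 * w) / 125)"
    using assms(2) by (simp add: u_def power_divide field_simps)
  also have "\<dots> \<le> ((w + 1) / (w - 1))\<^sup>2 * (sqrt (1 + h\<^sup>2 * w\<^sup>2) / sqrt (1 + h\<^sup>2))"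
    using C by (rule mult_left_mono) simp
  finally show ?thesis
    by (simp add: zigzag_cost_def)
qed

text \<open>In terms of \<open>t = h * w\<close> the first-order condition for the logarithm of the
  cost is the cubic equation \<open>eq\<close>. For \<open>h \<le> 3 / 4\<close> its coefficient
  \<open>4 * h\<close> is at most 3, and then the cubic is positive beyond 4.\<close>

lemma minimizer_slope_le_4:
  assumes "0 < h" "h \<le> 3 / 4" "w > 1" and min: "\<And>v. v > 1 \<Longrightarrow> zigzag_cost h w \<le> zigzag_cost h v"
  shows "h * w \<le> 4"
proof (rule ccontr)
  assume "\<not> h * w \<le> 4"
  define t where "t = h * w"
  have t: "t > 4"
    using \<open>\<not> h * w \<le> 4\<close> by (simp add: t_def)
  let ?G = "\<lambda>x. 2 * ln (x + 1) - 2 * ln (x - 1) + ln (1 + h\<^sup>2 * x\<^sup>2) / 2"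
  have pos: "1 + h\<^sup>2 * x\<^sup>2 > 0" for x
    by (simp add: add_pos_nonneg)
  have G: "exp (?G x) = zigzag_cost h x" if "x > 1" for x
    using that pos[of x]
    by (simp add: zigzag_cost_def exp_add exp_diff power_divide exp_double ln_sqrt[symmetric] real_sqrt_gt_zero)
  have der: "(?G has_real_derivative (- 4 / (w\<^sup>2 - 1) + h\<^sup>2 * w / (1 + h\<^sup>2 * w\<^sup>2))) (at w)"
    using assms(3) pos[of w]
    by (auto intro!: derivative_eq_intros) (simp add: field_simps power2_eq_square)
  have "- 4 / (w\<^sup>2 - 1) + h\<^sup>2 * w / (1 + h\<^sup>2 * w\<^sup>2) = 0"
  proof (rule DERIV_local_min[OF der, of "w - 1"])
    \<comment> \<open>The radius \<open>w - 1\<close> keeps the neighbourhood inside the domain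
      \<open>y > 1\<close>.\<close>
    show "\<forall>y. \<bar>w - y\<bar> < w - 1 \<longrightarrow> ?G w \<le> ?G y"
    proof (intro allI impI)
      fix y assume "\<bar>w - y\<bar> < w - 1"
      then have "y > 1"
        by simp
      then have "exp (?G w) \<le> exp (?G y)"
        unfolding G[OF assms(3)] G[OF \<open>y > 1\<close>] by (rule min)
      then show "?G w \<le> ?G y"
        by (simp only: exp_le_cancel_iff)
    qed
  qed (use assms(3) in simp)
  moreover have "w\<^sup>2 - 1 > 0"
    using assms(3) by (simp add: power2_eq_square less_1_mult)
  moreover have "b * a = 4 * c" if "- 4 / a + b / c = 0" "a > 0" "c > 0" for a b c :: real
    using that by (simp add: field_simps)
  ultimately have "h\<^sup>2 * w * (w\<^sup>2 - 1) = 4 * (1 + h\<^sup>2 * w\<^sup>2)"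
    using pos[of w] by blast
  then have "h * (h\<^sup>2 * w * (w\<^sup>2 - 1)) = h * (4 * (1 + h\<^sup>2 * w\<^sup>2))"
    by simp
  then have eq: "t ^ 3 - 4 * h * t\<^sup>2 - h\<^sup>2 * t - 4 * h = 0"
    by (simp add: t_def power2_eq_square power3_eq_cube algebra_simps)
  have "h\<^sup>2 \<le> 1"
    using assms(1,2) by (simp add: power_le_one)
  then have "h\<^sup>2 * t \<le> 1 * t" "4 * h * t\<^sup>2 \<le> 3 * t\<^sup>2"
    using t assms(2) by (auto intro!: mult_right_mono)
  moreover have "t * (t * (t - 3) - 1) \<ge> 4 * (4 * (4 - 3) - 1)"
    using t by (intro mult_mono diff_mono) auto
  ultimately show False
    using eq assms(2) by (simp add: power2_eq_square power3_eq_cube algebra_simps)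
qed

text \<open>After the reflection \<open>v = - z\<close> the quotient increases on the unit interval,
  by the sign of its logarithmic derivative, and for negative \<open>v\<close> it is at most 1, its
  value at 0. Up to a common factor the two sides are the cost of a point just missed in the
  direction of slope \<open>h * z\<close> and of its counterpart on a side of the wedge.\<close>

lemma zigzag_direction_bound:
  assumes "0 < h" "w > 1" "h * w \<le> 4" "- 1 \<le> z" "z \<le> 1"
  shows "(w - z) / ((w + z) * sqrt (1 + h\<^sup>2 * z\<^sup>2)) \<le> (w + 1) / ((w - 1) * sqrt (1 + h\<^sup>2))"
proof -
  have pos: "1 + h\<^sup>2 * x\<^sup>2 > 0" for x
    by (simp add: add_pos_nonneg)
  let ?g = "\<lambda>v. (w + v) / ((w - v) * sqrt (1 + h\<^sup>2 * v\<^sup>2))"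
  let ?G = "\<lambda>v. ln (w + v) - ln (w - v) - ln (1 + h\<^sup>2 * v\<^sup>2) / 2"
  have G: "exp (?G v) = ?g v" if "\<bar>v\<bar> \<le> 1" for v
    using that pos[of v] assms(2)
    by (simp add: exp_diff ln_sqrt[symmetric] real_sqrt_gt_zero)
  have mono: "?g v \<le> ?g 1" if v: "0 \<le> v" "v \<le> 1" for v
  proof -
    have "?G v \<le> ?G 1"
    proof (rule DERIV_nonneg_imp_nondecreasing[OF v(2)])
      fix x assume x: "v \<le> x" "x \<le> 1"
      have der: "(?G has_real_derivative (1 / (w + x) + 1 / (w - x) - h\<^sup>2 * x / (1 + h\<^sup>2 * x\<^sup>2))) (at x)"
        using assms(2) pos[of x] x v
        by (auto intro!: derivative_eq_intros) (simp add: field_simps power2_eq_square)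
      \<comment> \<open>Here \<open>h * w \<le> 4\<close> enters: 4 is the constant that
        \<open>2 * (h * x) \<le> 1 + (h * x)\<^sup>2\<close> can absorb.\<close>
      have "h * (h * x * w) \<le> h * (x * 4)"
        using assms(1,3) x v mult_left_mono[OF assms(3), of x]
        by (intro mult_left_mono) (auto simp: algebra_simps)
      also have "\<dots> \<le> 2 * (1 + h\<^sup>2 * x\<^sup>2)"
        using zero_le_power2[of "1 - h * x"] by (simp add: power2_eq_square algebra_simps)
      finally have "h * (h * x * w) * w \<le> 2 * (1 + h\<^sup>2 * x\<^sup>2) * w"
        using assms(2) by (intro mult_right_mono) auto
      then have "h\<^sup>2 * x * w * w \<le> 2 * (1 + h\<^sup>2 * x\<^sup>2) * w"
        by (simp add: power2_eq_square mult.assoc)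
      moreover have "h\<^sup>2 * x * (w\<^sup>2 - x\<^sup>2) \<le> h\<^sup>2 * x * w * w"
        using assms(1) x v by (simp add: power2_eq_square algebra_simps)
      ultimately have "h\<^sup>2 * x * (w\<^sup>2 - x\<^sup>2) \<le> 2 * w * (1 + h\<^sup>2 * x\<^sup>2)"
        by (simp add: algebra_simps)
      moreover have "w\<^sup>2 - x\<^sup>2 = (w + x) * (w - x)"
        by (simp add: power2_eq_square algebra_simps)
      moreover have "(w + x) * (w - x) > 0"
        using x v assms(2) by (intro mult_pos_pos) auto
      moreover have "1 / (w + x) + 1 / (w - x) = 2 * w / ((w + x) * (w - x))"
        using x v assms(2) by (simp add: field_simps)
      ultimately have "0 \<le> 1 / (w + x) + 1 / (w - x) - h\<^sup>2 * x / (1 + h\<^sup>2 * x\<^sup>2)"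
        using pos[of x] by (simp add: pos_divide_le_eq pos_le_divide_eq mult.commute)
      with der show "\<exists>y. (?G has_real_derivative y) (at x) \<and> 0 \<le> y"
        by blast
    qed
    then have "exp (?G v) \<le> exp (?G 1)"
      by (simp only: exp_le_cancel_iff)
    then show ?thesis
      using v by (simp only: G abs_of_nonneg abs_one order_refl zero_le_one)
  qed
  have "?g (- z) \<le> ?g 1"
  proof (cases "z \<le> 0")
    case True
    then show ?thesis
      using mono[of "- z"] assms(4) by simp
  next
    case False
    have "1 \<le> sqrt (1 + h\<^sup>2 * z\<^sup>2)"
      by simp
    then have "(w + z) * 1 \<le> (w + z) * sqrt (1 + h\<^sup>2 * z\<^sup>2)"
      using False assms(2) by (intro mult_left_mono) auto
    then have "w - z \<le> (w + z) * sqrt (1 + h\<^sup>2 * z\<^sup>2)"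
      using False by simp
    moreover have "0 < (w + z) * sqrt (1 + h\<^sup>2 * z\<^sup>2)"
      using False assms(2) pos[of z] by (intro mult_pos_pos) auto
    ultimately have "?g (- z) \<le> 1"
      by (simp add: divide_le_eq_1_pos)
    also have "1 \<le> ?g 1"
      using mono[of 0] assms(2) by simp
    finally show ?thesis .
  qed
  then show ?thesis
    by simp
qed

section \<open>Existence of a suitable spiral rate\<close>

lemma pi_le_315: "pi \<le> 63 / 20"
proof (rule ccontr)
  assume "\<not> pi \<le> 63 / 20"
  \<comment> \<open>\<open>21 / 40\<close> is one sixth of \<open>63 / 20\<close>, and the Taylor
    polynomial shows that its sine exceeds 1/2.\<close>
  then have "sin (21 / 40) < sin (pi / 6)"
    using pi_gt3 by (intro sin_monotone_2pi) auto
  moreover have "\<bar>sin (21 / 40 :: real) - (21 / 40 - (21 / 40) ^ 3 / 6)\<bar> \<le> (21 / 40) ^ 5 / 120"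
    using Maclaurin_sin_bound[of "21 / 40" 5]
    by (simp add: lessThan_nat_numeral lessThan_Suc sin_coeff_def fact_numeral power_divide)
  ultimately show False
    by (simp add: sin_30 abs_le_iff power_divide)
qed

text \<open>Since \<open>7 / 4 = 2 - 1 / 4\<close>, an upper bound for \<open>exp 1\<close> and a
  lower one for \<open>exp (1 / 4)\<close> are enough.\<close>

lemma exp_7_4_le: "exp (7 / 4 :: real) \<le> 578 / 100"
proof -
  have "exp (1 / 4) * exp (7 / 4 :: real) = exp 1 * exp 1"
    by (simp flip: exp_add)
  also have "\<dots> \<le> 272 / 100 * (272 / 100)"
    using e_less_272 by (intro mult_mono) auto
  finally have "exp (1 / 4) * exp (7 / 4 :: real) \<le> 272 / 100 * (272 / 100)" .
  moreover have "41 / 32 * exp (7 / 4) \<le> exp (1 / 4) * exp (7 / 4 :: real)"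
    using exp_lower_Taylor_quadratic[of "1 / 4"] by (intro mult_right_mono) (auto simp: power_divide)
  ultimately show ?thesis
    by linarith
qed

text \<open>The rate is raised from a trial value \<open>k0\<close> until the product equals
  \<open>G\<close>. As \<open>1 + 1 / k\<^sup>2\<close> decreases in \<open>k\<close>, its bound at
  \<open>k0\<close> survives; it later limits the length per radius to 4.\<close>

lemma log_spiral_rate_exists:
  assumes "408 / 5 \<le> G"
  obtains k where "k > 0" "1 + 1 / k\<^sup>2 \<le> 14" "(1 + 1 / k\<^sup>2) * exp (2 * pi * k) = G"
proof -
  \<comment> \<open>Chosen to make \<open>2 * pi * k0\<close> the rational \<open>7 / 4\<close>; it
    is close to the minimizer of the product, whose value there is below
    \<open>408 / 5\<close>.\<close>
  define k0 where "k0 = 7 / (8 * pi)"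
  have k0: "k0 > 0"
    by (simp add: k0_def)
  let ?g = "\<lambda>k::real. (1 + 1 / k\<^sup>2) * exp (2 * pi * k)"
  have "pi\<^sup>2 \<le> (63 / 20)\<^sup>2"
    using pi_le_315 by (intro power_mono) auto
  then have q0: "1 + 1 / k0\<^sup>2 \<le> 1397 / 100"
    by (simp add: k0_def power_divide power_mult_distrib)
  have "k0 \<le> 1"
    using pi_gt3 by (simp add: k0_def)
  then have k0_G: "k0 \<le> G"
    using assms by simp
  have "2 * pi * k0 = 7 / 4"
    by (simp add: k0_def)
  with exp_7_4_le have "exp (2 * pi * k0) \<le> 578 / 100"
    by (simp only:)
  with q0 have "?g k0 \<le> 1397 / 100 * (578 / 100)"
    by (intro mult_mono) auto
  then have "?g k0 \<le> G"
    using assms by linarith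
  moreover have "G \<le> ?g G"
  proof -
    have "G \<le> 2 * pi * G"
      using pi_gt3 assms by (simp add: mult_le_cancel_right1)
    also have "\<dots> \<le> exp (2 * pi * G)"
      using exp_ge_add_one_self[of "2 * pi * G"] by linarith
    also have "\<dots> \<le> ?g G"
      by (simp add: mult_le_cancel_right1)
    finally show ?thesis .
  qed
  moreover have "continuous_on {k0..G} ?g"
    using k0 by (intro continuous_intros) auto
  ultimately obtain k where k: "k0 \<le> k" "?g k = G"
    using IVT'[of ?g k0 G G] k0_G by blast
  have "1 / k\<^sup>2 \<le> 1 / k0\<^sup>2"
    using k(1) k0 by (intro divide_left_mono power_mono) auto
  then show thesis
    using k k0 q0 by (intro that[of k]) auto
qed

section \<open>Spirals\<close>

text \<open>\<open>n\<close> is the first round whose radius reaches \<open>y\<close>, and the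
  failure of the round before limits the overshoot to a factor \<open>E\<close>.\<close>

lemma ex_power_int_bracket:
  assumes "E > 1" "r > 0" "y > (0 :: real)"
  obtains n :: int where "E powi (n - 1) * r < y" "y \<le> E powi n * r"
proof -
  define n where "n = \<lceil>log E (y / r)\<rceil>"
  have "of_int n - 1 < log E (y / r)" "log E (y / r) \<le> of_int n"
    unfolding n_def by linarith+
  then have "E powr of_int (n - 1) < y / r" "y / r \<le> E powr of_int n"
    using assms by (simp_all add: less_log_iff log_le_iff)
  moreover have "E powr (of_int n - 1) = E powi (n - 1)" "E powr of_int n = E powi n"
    using assms powr_real_of_int'[of E "n - 1"] powr_real_of_int'[of E n] by simp_all
  ultimately have "E powi (n - 1) < y / r" "y / r \<le> E powi n"
    by simp_all
  then show thesis
    using assms by (intro that[of n]) (simp_all add: field_simps)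
qed

lemma power_int_eq_mult:
  assumes "E > (0 :: real)"
  shows "E powi n = E * E powi (n - 1)"
  using assms by (simp add: power_int_diff)

lemma power_int_gt_1D:
  assumes "E > (1 :: real)" "E powi n > 1"
  shows "n \<ge> 1"
proof (rule ccontr)
  assume "\<not> n \<ge> 1"
  then have "E powi n \<le> E powi 0"
    using assms(1) by (intro power_int_increasing) auto
  with assms(2) show False
    by simp
qed

context self_similar_curve
begin

lemma self_similar_values:
  assumes "s \<in> {0..1}"
  shows "self_similar E f g (2 * of_int n + s) = E powi n *\<^sub>R f s"
    and "self_similar E f g (2 * of_int n + 1 + s) = E powi n *\<^sub>R g s"
    and "self_similar E l m (2 * of_int n + s) = E powi n * l s"
    and "self_similar E l m (2 * of_int n + 1 + s) = E powi n * m s"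
  using assms self_similar_at[of f g E s n] self_similar_at[of l m E s n] E fg lm by simp_all

lemma exposure_time_le:
  assumes "s \<in> {0..1}" "c > 0" "U \<noteq> 0" "0 < y" "y \<le> E powi n * r"
  shows "f s = r *\<^sub>R U \<Longrightarrow>
      exposure_time (self_similar E f g) c (y *\<^sub>R U) \<le> ennreal (E powi n * l s / c)"
    and "g s = r *\<^sub>R U \<Longrightarrow>
      exposure_time (self_similar E f g) c (y *\<^sub>R U) \<le> ennreal (E powi n * m s / c)"
proof -
  have ex: "exposes ((E powi n * r) *\<^sub>R U) (y *\<^sub>R U)"
    unfolding exposes_iff using assms(3-5)
    by (auto intro!: exI[of _ "E powi n * r / y"])
  show "exposure_time (self_similar E f g) c (y *\<^sub>R U) \<le> ennreal (E powi n * l s / c)"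
    if "f s = r *\<^sub>R U"
    using ex that assms(1,2)
    by (intro exposure_time_le[OF search_curve, of "2 * of_int n + s"]) (simp_all add: self_similar_values len_upto)
  show "exposure_time (self_similar E f g) c (y *\<^sub>R U) \<le> ennreal (E powi n * m s / c)"
    if "g s = r *\<^sub>R U"
    using ex that assms(1,2)
    by (intro exposure_time_le[OF search_curve, of "2 * of_int n + 1 + s"]) (simp_all add: self_similar_values len_upto)
qed

text \<open>The pieces are taken half-open: the end of each is the start of the next.\<close>

lemma exposure_time_ge:
  assumes "c > 0" "b \<ge> 0"
    and "\<And>n s. 0 \<le> s \<Longrightarrow> s < 1 \<Longrightarrow> exposes (E powi n *\<^sub>R f s) A \<Longrightarrow> b \<le> E powi n * l s"
    and "\<And>n s. 0 \<le> s \<Longrightarrow> s < 1 \<Longrightarrow> exposes (E powi n *\<^sub>R g s) A \<Longrightarrow> b \<le> E powi n * m s"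
  shows "ennreal (b / c) \<le> exposure_time (self_similar E f g) c A"
proof (rule exposure_time_ge[OF search_curve assms(1,2)])
  fix t assume t: "exposes (self_similar E f g t) A"
  show "ennreal b \<le> len_upto (self_similar E f g) t"
  proof (cases t rule: self_similar_cases)
    case (fst n s)
    then show ?thesis
      using t assms(3)[of s n] by (simp add: self_similar_values len_upto ennreal_leI)
  next
    case (snd n s)
    then show ?thesis
      using t assms(4)[of s n] by (simp add: self_similar_values len_upto ennreal_leI)
  qed
qed

end

section \<open>Spiral arcs and chords\<close>

definition spiral_arc :: "real \<Rightarrow> real \<Rightarrow> real \<Rightarrow> real \<Rightarrow> real \<Rightarrow> real \<times> real" where
  "spiral_arc b k a w s = polar (b * exp (k * w * s)) (a + w * s)"

definition spiral_velocity :: "real \<Rightarrow> real \<Rightarrow> real \<Rightarrow> real \<Rightarrow> real \<Rightarrow> real \<times> real" where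
  "spiral_velocity b k a w s = (b * w * exp (k * w * s)) *\<^sub>R
     (k * cos (a + w * s) - sin (a + w * s), k * sin (a + w * s) + cos (a + w * s))"

text \<open>Measured from the origin: the infinitely many inward turns of a logarithmic spiral have
  total length \<open>sqrt (1 + 1 / k\<^sup>2)\<close> times the radius reached.\<close>

definition spiral_length :: "real \<Rightarrow> real \<Rightarrow> real \<Rightarrow> real \<Rightarrow> real" where
  "spiral_length b k w s = sqrt (1 + 1 / k\<^sup>2) * b * exp (k * w * s)"

lemma spiral_arc_has_vector_derivative: "(spiral_arc b k a w has_vector_derivative spiral_velocity b k a w s) (at s)"
proof -
  have "((\<lambda>s. b * exp (k * w * s) * cos (a + w * s)) has_real_derivative
      b * w * exp (k * w * s) * (k * cos (a + w * s) - sin (a + w * s))) (at s)"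
    "((\<lambda>s. b * exp (k * w * s) * sin (a + w * s)) has_real_derivative
      b * w * exp (k * w * s) * (k * sin (a + w * s) + cos (a + w * s))) (at s)"
    by (auto intro!: derivative_eq_intros simp: algebra_simps)
  then show ?thesis
    using has_vector_derivative_Pair
    unfolding spiral_arc_def spiral_velocity_def polar_def has_real_derivative_iff_has_vector_derivative
    by fastforce
qed

lemma norm_spiral_velocity:
  assumes "b > 0" "w > 0"
  shows "norm (spiral_velocity b k a w s) = b * w * exp (k * w * s) * sqrt (1 + k\<^sup>2)"
proof -
  define C S where "C = cos (a + w * s)" and "S = sin (a + w * s)"
  have "(k * C - S)\<^sup>2 + (k * S + C)\<^sup>2 = (1 + k\<^sup>2) * (S\<^sup>2 + C\<^sup>2)"
    by (simp add: power2_eq_square algebra_simps)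
  also have "\<dots> = 1 + k\<^sup>2"
    by (simp add: C_def S_def)
  finally show ?thesis
    unfolding spiral_velocity_def norm_scaleR using assms
    by (simp add: norm_Pair flip: C_def S_def)
qed

lemma spiral_length_has_derivative:
  assumes "b > 0" "k > 0" "w > 0"
  shows "(spiral_length b k w has_real_derivative norm (spiral_velocity b k a w s)) (at s)"
proof -
  have "k * sqrt (1 + 1 / k\<^sup>2) = sqrt (k\<^sup>2 * (1 + 1 / k\<^sup>2))"
    using assms by (simp add: real_sqrt_mult)
  also have "k\<^sup>2 * (1 + 1 / k\<^sup>2) = 1 + k\<^sup>2"
    using assms by (simp add: field_simps)
  finally have *: "k * sqrt (1 + 1 / k\<^sup>2) = sqrt (1 + k\<^sup>2)" .
  have "(spiral_length b k w has_real_derivative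
      (k * sqrt (1 + 1 / k\<^sup>2)) * (b * w * exp (k * w * s))) (at s)"
    unfolding spiral_length_def by (auto intro!: derivative_eq_intros)
  then show ?thesis
    using assms unfolding * by (simp add: norm_spiral_velocity mult.commute)
qed

definition chord :: "real \<times> real \<Rightarrow> real \<times> real \<Rightarrow> real \<Rightarrow> real \<times> real" where
  "chord P Q s = P + s *\<^sub>R (Q - P)"

lemma chord_has_vector_derivative: "(chord P Q has_vector_derivative Q - P) (at s)"
  unfolding chord_def by (auto intro!: derivative_eq_intros)

lemma linear_has_real_derivative: "((\<lambda>s. a + s * v) has_real_derivative v) (at s)"
  by (auto intro!: derivative_eq_intros)

text \<open>Split into two half turns, since a round consists of two pieces.\<close>

definition log_spiral :: "real \<Rightarrow> real \<Rightarrow> real \<Rightarrow> real \<times> real" where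
  "log_spiral b k = self_similar (exp (2 * pi * k)) (spiral_arc b k 0 pi) (spiral_arc (b * exp (k * pi)) k pi pi)"

lemma log_spiral_locale:
  assumes "b > 0" "k > 0"
  shows "self_similar_curve (exp (2 * pi * k)) (spiral_arc b k 0 pi) (spiral_arc (b * exp (k * pi)) k pi pi)
    (spiral_velocity b k 0 pi) (spiral_velocity (b * exp (k * pi)) k pi pi)
    (spiral_length b k pi) (spiral_length (b * exp (k * pi)) k pi)"
proof
  have e: "exp (2 * pi * k) = exp (k * pi) * exp (k * pi)"
    by (simp flip: exp_add)
  show "1 < exp (2 * pi * k)"
    using assms by simp
  show "spiral_arc (b * exp (k * pi)) k pi pi 1 = exp (2 * pi * k) *\<^sub>R spiral_arc b k 0 pi 0"
    by (simp add: spiral_arc_def polar_def e)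
  show "spiral_length (b * exp (k * pi)) k pi 1 = exp (2 * pi * k) * spiral_length b k pi 0"
    by (simp add: spiral_length_def e)
qed (use assms in \<open>auto intro!: spiral_arc_has_vector_derivative spiral_length_has_derivative
      simp: spiral_arc_def spiral_length_def\<close>)

lemma spiral_arc_eq: "spiral_arc b k a w s = (b * exp (k * w * s)) *\<^sub>R polar 1 (a + w * s)"
  by (simp add: spiral_arc_def polar_def)

lemma polar_1_neq_0 [simp]: "polar 1 t \<noteq> 0"
  using norm_polar[of 1 t] by (metis abs_one norm_zero zero_neq_one)

lemma log_spiral_exposure_time_le:
  assumes "b > 0" "k > 0" "c > 0" "0 \<le> \<psi>" "\<psi> < 2 * pi"
    and "0 < y" "y \<le> exp (2 * pi * k) powi n * (b * exp (k * \<psi>))"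
  shows "exposure_time (log_spiral b k) c (y *\<^sub>R polar 1 \<psi>)
    \<le> ennreal (exp (2 * pi * k) powi n * (sqrt (1 + 1 / k\<^sup>2) * b * exp (k * \<psi>)) / c)"
proof -
  interpret self_similar_curve "exp (2 * pi * k)" "spiral_arc b k 0 pi" "spiral_arc (b * exp (k * pi)) k pi pi"
    "spiral_velocity b k 0 pi" "spiral_velocity (b * exp (k * pi)) k pi pi"
    "spiral_length b k pi" "spiral_length (b * exp (k * pi)) k pi"
    by (rule log_spiral_locale[OF assms(1,2)])
  show ?thesis
  proof (cases "\<psi> \<le> pi")
    case True
    have "exposure_time (log_spiral b k) c (y *\<^sub>R polar 1 \<psi>)
      \<le> ennreal (exp (2 * pi * k) powi n * spiral_length b k pi (\<psi> / pi) / c)"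
      unfolding log_spiral_def using assms True
      by (intro exposure_time_le(1)[where r = "b * exp (k * \<psi>)"]) (auto simp: spiral_arc_eq)
    then show ?thesis
      by (simp add: spiral_length_def)
  next
    case False
    define s where "s = (\<psi> - pi) / pi"
    have s: "0 \<le> s" "s \<le> 1" "\<psi> = pi + pi * s"
      using False assms(5) by (auto simp: s_def field_simps)
    have e: "exp (k * \<psi>) = exp (k * pi) * exp (k * pi * s)"
      unfolding s(3) by (simp add: distrib_left flip: exp_add)
    have "exposure_time (log_spiral b k) c (y *\<^sub>R polar 1 \<psi>)
      \<le> ennreal (exp (2 * pi * k) powi n * spiral_length (b * exp (k * pi)) k pi s / c)"
      unfolding log_spiral_def using assms s(1,2)
      by (intro exposure_time_le(2)[where r = "b * exp (k * \<psi>)"])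
        (simp_all add: spiral_arc_eq e flip: s(3))
    then show ?thesis
      by (simp add: spiral_length_def e mult.assoc)
  qed
qed

text \<open>A round meets the positive axis only at its start, and the radii there increase; if
  round \<open>n - 1\<close> falls short of \<open>y\<close>, so do all earlier ones.\<close>

lemma log_spiral_exposure_time_ge:
  assumes "b > 0" "k > 0" "c > 0" "y > 0" "exp (2 * pi * k) powi (n - 1) * b < y"
  shows "ennreal (exp (2 * pi * k) powi n * (sqrt (1 + 1 / k\<^sup>2) * b) / c)
    \<le> exposure_time (log_spiral b k) c (y, 0)"
proof -
  interpret self_similar_curve "exp (2 * pi * k)" "spiral_arc b k 0 pi" "spiral_arc (b * exp (k * pi)) k pi pi"
    "spiral_velocity b k 0 pi" "spiral_velocity (b * exp (k * pi)) k pi pi"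
    "spiral_length b k pi" "spiral_length (b * exp (k * pi)) k pi"
    by (rule log_spiral_locale[OF assms(1,2)])
  let ?E = "exp (2 * pi * k)"
  \<comment> \<open>The bound \<open>a < 2 * pi\<close> leaves out the end of a round, which counts
    as the start of the next.\<close>
  have angle: "a = 0" if ex: "exposes (?E powi i *\<^sub>R spiral_arc b' k a' pi s) (y, 0)"
    and b': "b' > 0" and a: "0 \<le> a" "a < 2 * pi" "a' + pi * s = a" for i b' a' s a
  proof -
    obtain d where d: "d \<ge> 1" "?E powi i *\<^sub>R spiral_arc b' k a' pi s = d *\<^sub>R (y, 0)"
      using ex by (rule exposesE)
    define p where "p = ?E powi i * (b' * exp (k * pi * s))"
    have "p > 0"
      using b' by (simp add: p_def)
    have "p * cos a = d * y" "p * sin a = 0"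
      using d(2) a(3) by (auto simp: spiral_arc_def polar_def p_def mult.assoc)
    then have ca: "cos a > 0" and sa: "sin a = 0"
      using \<open>p > 0\<close> d(1) assms(4) by (auto simp: zero_less_mult_iff dest: sym)
        (smt (verit) mult_pos_pos zero_less_mult_pos)
    show "a = 0"
    proof (rule ccontr)
      assume "a \<noteq> 0"
      then consider "0 < a" "a < pi" | "a = pi" | "pi < a"
        using a(1) by linarith
      then show False
      proof cases
        case 1
        then show False
          using sin_gt_zero sa by fastforce
      next
        case 2
        then show False
          using ca by simp
      next
        case 3
        then show False
          using sin_lt_zero[of a] sa a(2) by simp
      qed
    qed
  qed
  show ?thesis
    unfolding log_spiral_def
  proof (rule exposure_time_ge)
    fix i s assume s: "0 \<le> s" "s < (1::real)" and ex: "exposes (?E powi i *\<^sub>R spiral_arc b k 0 pi s) (y, 0)"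
    have "pi * s = 0"
      using s assms(1) by (intro angle[OF ex]) (auto simp: mult_less_cancel_left2 intro: less_le_trans)
    then have "s = 0"
      by simp
    then have "y \<le> ?E powi i * b"
      using ex assms(4) by (auto simp: exposes_iff spiral_arc_def polar_def mult_le_cancel_right1)
    then have "?E powi (n - 1) < ?E powi i"
      using assms(1,5) by (meson less_le_trans mult_less_cancel_right_pos)
    then have "n \<le> i"
      using assms(2) power_int_increasing[of i "n - 1" ?E] by force
    then have "?E powi n \<le> ?E powi i"
      using assms(2) by (intro power_int_increasing) auto
    then show "?E powi n * (sqrt (1 + 1 / k\<^sup>2) * b) \<le> ?E powi i * spiral_length b k pi s"
      using assms(1) \<open>s = 0\<close> by (simp add: spiral_length_def mult_right_mono)
  next
    fix i s assume s: "0 \<le> s" "s < (1::real)"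
      and ex: "exposes (?E powi i *\<^sub>R spiral_arc (b * exp (k * pi)) k pi pi s) (y, 0)"
    have "pi + pi * s = 0"
      using s assms(1) mult_strict_left_mono[of s 1 pi] by (intro angle[OF ex]) auto
    moreover have "pi + pi * s > 0"
      using s by (intro add_pos_nonneg) auto
    ultimately show "?E powi n * (sqrt (1 + 1 / k\<^sup>2) * b) \<le>
        ?E powi i * spiral_length (b * exp (k * pi)) k pi s"
      by simp
  qed (use assms in auto)
qed

text \<open>The two spirals have the same rate, and the ratio \<^term>\<open>b\<close> of their radii is chosen so that a
  point just missed by one agent costs the other one \<^term>\<open>S\<close>, whichever of the two missed it.\<close>

lemma two_spirals_admit:
  assumes "12 \<le> S" "34 / 5 \<le> c * S" "408 / 5 \<le> c * S\<^sup>2" "c > 0"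
  shows "MSP_admits punctured_plane 2 (\<lambda>i. [1, c] ! i) S"
proof -
  obtain k where k: "k > 0" "1 + 1 / k\<^sup>2 \<le> 14" "(1 + 1 / k\<^sup>2) * exp (2 * pi * k) = c * S\<^sup>2"
    using log_spiral_rate_exists[OF assms(3)] by blast
  define q where "q = sqrt (1 + 1 / k\<^sup>2)"
  define b where "b = q / S"
  define E where "E = exp (2 * pi * k)"
  have "q > 0"
    unfolding q_def using k(1) by (simp add: add_pos_nonneg)
  have "q\<^sup>2 = 1 + 1 / k\<^sup>2"
    by (simp add: q_def)
  then have q2: "q\<^sup>2 \<le> 4\<^sup>2" and qE: "q\<^sup>2 * E = c * S\<^sup>2"
    using k by (simp_all add: E_def)
  then have "q \<le> 4"
    by (intro power2_le_imp_le[OF q2]) auto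
  have "E > 1"
    using k(1) by (simp add: E_def)
  have b: "b > 0" "S * b = q"
    using \<open>q > 0\<close> assms(1) by (auto simp: b_def)
  have Eb: "E * q * b = c * S"
    using qE assms(1) by (simp add: b_def power2_eq_square field_simps)
  note locale0 = log_spiral_locale[OF zero_less_one k(1)]
  note locale1 = log_spiral_locale[OF b(1) k(1)]
  show ?thesis
  proof (rule MSP2_admitsI)
    show "search_curve (log_spiral 1 k)" "search_curve (log_spiral b k)"
      unfolding log_spiral_def
      by (rule self_similar_curve.search_curve[OF locale0] self_similar_curve.search_curve[OF locale1])+
    fix A :: "real \<times> real" assume "A \<noteq> 0"
    obtain \<psi> where \<psi>: "0 \<le> \<psi>" "\<psi> < 2 * pi" "A = polar (norm A) \<psi>"
      by (rule polar_form)
    define y where "y = norm A"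
    have y: "y > 0" and A: "A = y *\<^sub>R polar 1 \<psi>"
      using \<open>A \<noteq> 0\<close> \<psi>(3) polar_scaleR[of y \<psi>] by (auto simp: y_def)
    define r where "r = exp (k * \<psi>)"
    obtain n where n: "E powi (n - 1) * r < y" "y \<le> E powi n * r"
      using ex_power_int_bracket[OF \<open>E > 1\<close> _ y, of r] by (auto simp: r_def)
    show "exposure_time (log_spiral 1 k) 1 A \<le> ennreal (S * norm A) \<or>
      exposure_time (log_spiral b k) c A \<le> ennreal (S * norm A)"
    \<comment> \<open>In this direction the agents pass at the radii \<open>E powi i * r\<close> and
      \<open>E powi i * (b * r)\<close>. Either the second agent arrives in round \<open>n\<close>,
      after the first one missed the point in round \<open>n - 1\<close>, or the second misses it in
      round \<open>n\<close> and the first arrives in that round.\<close>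
    proof (cases "y \<le> E powi n * (b * r)")
      case True
      have "exposure_time (log_spiral b k) c A \<le> ennreal (E powi n * (q * b * r) / c)"
        unfolding A q_def r_def E_def using b k assms(4) \<psi> y True
        by (intro log_spiral_exposure_time_le) (auto simp: E_def r_def)
      also have "E powi n = E * E powi (n - 1)"
        using \<open>E > 1\<close> by (simp add: power_int_diff)
      also have "E * E powi (n - 1) * (q * b * r) / c = (E * q * b) / c * (E powi (n - 1) * r)"
        by simp
      also have "\<dots> = S * (E powi (n - 1) * r)"
        unfolding Eb using assms(4) by simp
      also have "ennreal \<dots> \<le> ennreal (S * y)"
        using n(1) assms(1) by (intro ennreal_leI mult_left_mono) auto
      finally show ?thesis
        by (simp add: y_def)
    next
      case False
      have "exposure_time (log_spiral 1 k) 1 A \<le> ennreal (E powi n * (q * 1 * r) / 1)"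
        unfolding A q_def r_def E_def using k \<psi> y n
        by (intro log_spiral_exposure_time_le) (auto simp: E_def r_def)
      also have "E powi n * (q * 1 * r) / 1 = S * (E powi n * (b * r))"
        by (simp flip: b(2))
      also have "ennreal \<dots> \<le> ennreal (S * y)"
        using False assms(1) by (intro ennreal_leI mult_left_mono) auto
      finally show ?thesis
        by (simp add: y_def)
    qed
  next
    fix e :: real assume e: "e > 0"
    \<comment> \<open>Just beyond the radius \<open>b\<close> of the second agent in round 0: this
      agent must return a turn later, and the first one arrives with length \<open>q\<close> at the
      earliest.\<close>
    let ?A = "(b * (1 + e), 0) :: real \<times> real"
    have bpos: "b * (1 + e) > b"
      using b(1) e by simp
    have norm: "S * norm ?A / (1 + e) = q"
      using b e by (simp add: norm_Pair)
    \<comment> \<open>Ensures that the first agent, at radius \<open>inverse E\<close> in round -1,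
      has not yet exposed the point; the bounds \<open>34 / 5\<close> and \<open>q \<le> 4\<close>
      meet here.\<close>
    have "E * b = c * S / q"
      using Eb \<open>q > 0\<close> by (simp add: field_simps)
    also have "\<dots> \<ge> 1"
      using \<open>q > 0\<close> \<open>q \<le> 4\<close> assms(2) by simp
    finally have "inverse E \<le> b"
      using \<open>E > 1\<close> by (simp add: field_simps)
    then have "E powi (0 - 1) * 1 < b * (1 + e)"
      using bpos by (simp add: power_int_minus)
    then have "ennreal (E powi 0 * (q * 1) / 1) \<le> exposure_time (log_spiral 1 k) 1 ?A"
      unfolding E_def q_def using k(1) b(1) e by (intro log_spiral_exposure_time_ge) auto
    moreover have "ennreal (E powi 1 * (q * b) / c) \<le> exposure_time (log_spiral b k) c ?A"
      unfolding E_def q_def using k(1) b(1) e assms(4) bpos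
      by (intro log_spiral_exposure_time_ge) auto
    \<comment> \<open>As \<open>E * q * b = c * S\<close>, the right side is \<open>S\<close>, and
      \<open>S \<ge> 12\<close> exceeds \<open>q\<close>.\<close>
    moreover have "q \<le> E powi 1 * (q * b) / c"
      using Eb assms(1,4) \<open>q \<le> 4\<close> by (simp add: mult.assoc)
    ultimately show "\<exists>A. A \<noteq> 0 \<and>
      ennreal (S * norm A / (1 + e)) \<le> exposure_time (log_spiral 1 k) 1 A \<and>
      ennreal (S * norm A / (1 + e)) \<le> exposure_time (log_spiral b k) c A"
      using b(1) e norm
      by (intro exI[of _ ?A]) (auto simp: zero_prod_def intro: order_trans[OF ennreal_leI])
  qed (use assms in simp)
qed

section \<open>Searching a wedge and its complement\<close>

text \<open>The wedge is centred on the positive axis. The chord starts in the direction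
  \<open>- (\<phi> / 2)\<close>, which is the direction \<open>2 * pi - \<phi> / 2\<close> where the
  arc ends.\<close>

definition cut_spiral :: "real \<Rightarrow> real \<Rightarrow> real \<Rightarrow> real \<times> real" where
  "cut_spiral \<phi> l = (let k = spiral_rate \<phi> l; M = exp (k * (2 * pi - \<phi>)) in
     self_similar (l * M) (spiral_arc 1 k (\<phi> / 2) (2 * pi - \<phi>))
       (chord (polar M (- (\<phi> / 2))) (polar (l * M) (\<phi> / 2))))"

text \<open>By the choice of \<open>spiral_rate\<close> the chord has length
  \<open>sqrt (1 + 1 / k\<^sup>2) * M * (l - 1)\<close>. Total length at its end is therefore again
  \<open>sqrt (1 + 1 / k\<^sup>2)\<close> times the radius, as the closing condition on the lengths
  demands.\<close>

lemma cut_spiral_locale: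
  fixes \<phi> l :: real
  defines "k \<equiv> spiral_rate \<phi> l"
  defines "M \<equiv> exp (k * (2 * pi - \<phi>))"
  assumes "0 < \<phi>" "\<phi> < pi" "l > 1"
  shows "self_similar_curve (l * M) (spiral_arc 1 k (\<phi> / 2) (2 * pi - \<phi>))
    (chord (polar M (- (\<phi> / 2))) (polar (l * M) (\<phi> / 2)))
    (spiral_velocity 1 k (\<phi> / 2) (2 * pi - \<phi>)) (\<lambda>_. polar (l * M) (\<phi> / 2) - polar M (- (\<phi> / 2)))
    (spiral_length 1 k (2 * pi - \<phi>))
    (\<lambda>s. sqrt (1 + 1 / k\<^sup>2) * M + s * (sqrt (1 + 1 / k\<^sup>2) * M * (l - 1)))"
proof
  have k: "k > 0" and ratio: "sqrt (l\<^sup>2 - 2 * l * cos \<phi> + 1) = sqrt (1 + 1 / k\<^sup>2) * (l - 1)"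
    using chord_ratio[OF assms(3-5)] assms(5) by (auto simp: k_def field_simps)
  have M: "M > 1"
    using k assms(3,4) by (simp add: M_def)
  have "1 * 1 < l * M"
    using assms(5) M by (intro mult_strict_mono) auto
  then show "1 < l * M"
    by simp
  define C S where "C = cos (\<phi> / 2)" and "S = sin (\<phi> / 2)"
  have "(M * (l - 1) * C)\<^sup>2 + (M * (l + 1) * S)\<^sup>2 =
      M\<^sup>2 * ((l\<^sup>2 + 1) * (S\<^sup>2 + C\<^sup>2) - 2 * l * (C\<^sup>2 - S\<^sup>2))"
    by (simp add: power2_eq_square algebra_simps)
  also have "C\<^sup>2 - S\<^sup>2 = cos \<phi>"
    using cos_double[of "\<phi> / 2"] by (simp add: C_def S_def)
  also have "S\<^sup>2 + C\<^sup>2 = 1"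
    by (simp add: C_def S_def)
  also have "M\<^sup>2 * ((l\<^sup>2 + 1) * 1 - 2 * l * cos \<phi>) = M\<^sup>2 * (l\<^sup>2 - 2 * l * cos \<phi> + 1)"
    by simp
  finally have "sqrt ((M * (l - 1) * C)\<^sup>2 + (M * (l + 1) * S)\<^sup>2) =
      sqrt (M\<^sup>2 * (l\<^sup>2 - 2 * l * cos \<phi> + 1))"
    by (rule arg_cong)
  also have "\<dots> = M * sqrt (l\<^sup>2 - 2 * l * cos \<phi> + 1)"
    using M by (simp add: real_sqrt_mult)
  finally have "sqrt ((M * (l - 1) * C)\<^sup>2 + (M * (l + 1) * S)\<^sup>2) =
      M * sqrt (l\<^sup>2 - 2 * l * cos \<phi> + 1)" .
  moreover have "polar (l * M) (\<phi> / 2) - polar M (- (\<phi> / 2)) =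
      (M * (l - 1) * C, M * (l + 1) * S)"
    by (simp add: polar_def C_def S_def algebra_simps)
  ultimately have norm: "norm (polar (l * M) (\<phi> / 2) - polar M (- (\<phi> / 2))) = sqrt (1 + 1 / k\<^sup>2) * M * (l - 1)"
    by (simp add: norm_Pair ratio)
  show "((\<lambda>s. sqrt (1 + 1 / k\<^sup>2) * M + s * (sqrt (1 + 1 / k\<^sup>2) * M * (l - 1))) has_real_derivative
      norm (polar (l * M) (\<phi> / 2) - polar M (- (\<phi> / 2)))) (at s)" for s
    unfolding norm by (rule linear_has_real_derivative)
  show "(spiral_length 1 k (2 * pi - \<phi>) has_real_derivative
      norm (spiral_velocity 1 k (\<phi> / 2) (2 * pi - \<phi>) s)) (at s)" for s
    using k assms(4) pi_gt_zero by (intro spiral_length_has_derivative) linarith+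
  have "\<phi> / 2 + (2 * pi - \<phi>) = 2 * pi - \<phi> / 2"
    by simp
  then show "spiral_arc 1 k (\<phi> / 2) (2 * pi - \<phi>) 1 =
      chord (polar M (- (\<phi> / 2))) (polar (l * M) (\<phi> / 2)) 0"
    by (simp add: spiral_arc_def chord_def polar_def M_def cos_diff sin_diff)
  show "chord (polar M (- (\<phi> / 2))) (polar (l * M) (\<phi> / 2)) 1 =
      (l * M) *\<^sub>R spiral_arc 1 k (\<phi> / 2) (2 * pi - \<phi>) 0"
    by (simp add: spiral_arc_def chord_def polar_def)
  show "spiral_length 1 k (2 * pi - \<phi>) 1 =
      sqrt (1 + 1 / k\<^sup>2) * M + 0 * (sqrt (1 + 1 / k\<^sup>2) * M * (l - 1))"
    by (simp add: spiral_length_def M_def)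
  show "sqrt (1 + 1 / k\<^sup>2) * M + 1 * (sqrt (1 + 1 / k\<^sup>2) * M * (l - 1)) =
      l * M * spiral_length 1 k (2 * pi - \<phi>) 0"
    by (simp add: spiral_length_def algebra_simps)
qed (rule spiral_arc_has_vector_derivative chord_has_vector_derivative)+

text \<open>\<open>\<mu>\<close> solves \<open>(\<mu> + 1) / (\<mu> - 1) = w\<close>. For
  \<open>h * w = tan (\<theta> - \<phi> / 2)\<close> the legs make the angle
  \<open>\<theta> - \<phi> / 2\<close> with the axis of the wedge, which explains the angle in
  \<open>F_min\<close>.\<close>

definition zigzag :: "real \<Rightarrow> real \<Rightarrow> real \<Rightarrow> real \<times> real" where
  "zigzag h w = (let \<mu> = (w + 1) / (w - 1) in
     self_similar (\<mu>\<^sup>2) (chord (1, - h) (\<mu>, \<mu> * h)) (chord (\<mu>, \<mu> * h) (\<mu>\<^sup>2, - (\<mu>\<^sup>2 * h))))"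

text \<open>Along the zigzag the first coordinate increases and the slope is \<^term>\<open>h * w\<close> or
  \<^term>\<open>- (h * w)\<close>, so that the length is proportional to the first coordinate.\<close>

lemma zigzag_locale:
  fixes h w :: real
  defines "\<mu> \<equiv> (w + 1) / (w - 1)" and "D \<equiv> sqrt (1 + h\<^sup>2 * w\<^sup>2)"
  assumes "w > 1"
  shows "self_similar_curve (\<mu>\<^sup>2) (chord (1, - h) (\<mu>, \<mu> * h)) (chord (\<mu>, \<mu> * h) (\<mu>\<^sup>2, - (\<mu>\<^sup>2 * h)))
    (\<lambda>_. (\<mu>, \<mu> * h) - (1, - h)) (\<lambda>_. (\<mu>\<^sup>2, - (\<mu>\<^sup>2 * h)) - (\<mu>, \<mu> * h))
    (\<lambda>s. D + s * (D * (\<mu> - 1))) (\<lambda>s. D * \<mu> + s * (D * (\<mu> * (\<mu> - 1))))"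
proof
  have \<mu>: "\<mu> > 1" "\<mu> + 1 = w * (\<mu> - 1)"
    using assms(3) by (simp_all add: \<mu>_def field_simps)
  then show "1 < \<mu>\<^sup>2"
    by (intro one_less_power) auto
  have norm_step: "norm (a * (\<mu> - 1), h * (\<mu> + 1) * b) = D * (a * (\<mu> - 1))" if "a > 0" "b\<^sup>2 = a\<^sup>2" for a b
  proof -
    have "(a * (\<mu> - 1))\<^sup>2 + (h * (\<mu> + 1) * b)\<^sup>2 = (1 + h\<^sup>2 * w\<^sup>2) * (a * (\<mu> - 1))\<^sup>2"
      unfolding \<mu>(2) by (simp add: power_mult_distrib that(2) distrib_right distrib_left mult_ac)
    then show ?thesis
      using that(1) \<mu>(1) by (simp add: norm_Pair real_sqrt_mult D_def)
  qed
  have step: "(\<mu>, \<mu> * h) - (1, - h) = (1 * (\<mu> - 1), h * (\<mu> + 1) * 1)"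
    "(\<mu>\<^sup>2, - (\<mu>\<^sup>2 * h)) - (\<mu>, \<mu> * h) = (\<mu> * (\<mu> - 1), h * (\<mu> + 1) * (- \<mu>))"
    by (simp_all add: power2_eq_square algebra_simps)
  have norm: "norm ((\<mu>, \<mu> * h) - (1, - h)) = D * (\<mu> - 1)"
    "norm ((\<mu>\<^sup>2, - (\<mu>\<^sup>2 * h)) - (\<mu>, \<mu> * h)) = D * (\<mu> * (\<mu> - 1))"
    unfolding step using norm_step[of 1 1] norm_step[of \<mu> "- \<mu>"] \<mu>(1) by simp_all
  show "((\<lambda>s. D + s * (D * (\<mu> - 1))) has_real_derivative norm ((\<mu>, \<mu> * h) - (1, - h))) (at s)"
    "((\<lambda>s. D * \<mu> + s * (D * (\<mu> * (\<mu> - 1)))) has_real_derivative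
      norm ((\<mu>\<^sup>2, - (\<mu>\<^sup>2 * h)) - (\<mu>, \<mu> * h))) (at s)" for s
    unfolding norm by (rule linear_has_real_derivative)+
qed (rule chord_has_vector_derivative | simp add: chord_def power2_eq_square algebra_simps)+

text \<open>A ray of slope \<open>h * z\<close> is met twice per round, at first coordinates
  \<open>r\<close> and \<open>r'\<close>, which grow in turn by the factors
  \<open>\<mu> * ((w - z) / (w + z))\<close> and \<open>\<mu> * ((w + z) / (w - z))\<close>. A point
  just beyond one visit waits for the next, so the larger factor decides, and \<open>K\<close>
  bounds both quotients.\<close>

lemma zigzag_exposure_time_le:
  assumes "w > 1" "c > 0" "x > 0" "- 1 \<le> z" "z \<le> 1"
    and K: "(w - z) / (w + z) \<le> K" "(w + z) / (w - z) \<le> K"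
  shows "exposure_time (zigzag h w) c (x *\<^sub>R (1, h * z))
    \<le> ennreal (sqrt (1 + h\<^sup>2 * w\<^sup>2) * ((w + 1) / (w - 1)) * K * x / c)"
proof -
  define \<mu> where "\<mu> = (w + 1) / (w - 1)"
  define D where "D = sqrt (1 + h\<^sup>2 * w\<^sup>2)"
  interpret self_similar_curve "\<mu>\<^sup>2" "chord (1, - h) (\<mu>, \<mu> * h)" "chord (\<mu>, \<mu> * h) (\<mu>\<^sup>2, - (\<mu>\<^sup>2 * h))"
    "\<lambda>_. (\<mu>, \<mu> * h) - (1, - h)" "\<lambda>_. (\<mu>\<^sup>2, - (\<mu>\<^sup>2 * h)) - (\<mu>, \<mu> * h)"
    "\<lambda>s. D + s * (D * (\<mu> - 1))" "\<lambda>s. D * \<mu> + s * (D * (\<mu> * (\<mu> - 1)))"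
    unfolding \<mu>_def D_def by (rule zigzag_locale[OF assms(1)])
  have zigzag: "zigzag h w = self_similar (\<mu>\<^sup>2) (chord (1, - h) (\<mu>, \<mu> * h))
      (chord (\<mu>, \<mu> * h) (\<mu>\<^sup>2, - (\<mu>\<^sup>2 * h)))"
    unfolding zigzag_def Let_def \<mu>_def ..
  have \<mu>: "\<mu> > 1" "\<mu> - 1 = 2 / (w - 1)" "\<mu> + 1 = 2 * w / (w - 1)"
    using assms(1) by (simp_all add: \<mu>_def field_simps)
  have D: "D \<ge> 0"
    by (simp add: D_def)
  have wz: "w - z > 0" "w + z > 0"
    using assms by auto
  define r where "r = (w + 1) / (w - z)"
  define r' where "r' = \<mu> * ((w + 1) / (w + z))"
  \<comment> \<open>\<open>s\<close> and \<open>s'\<close> are the parameters at which the first and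
    the second leg meet the ray.\<close>
  define s where "s = (1 + z) * (w - 1) / (2 * (w - z))"
  define s' where "s' = (1 - z) * (w - 1) / (2 * (w + z))"
  have "0 \<le> (1 - z) * (w + 1)" "0 \<le> (1 + z) * (w + 1)"
    "0 \<le> (1 - z) * (w - 1)" "0 \<le> (1 + z) * (w - 1)"
    using assms by auto
  then have s: "s \<in> {0..1}" "s' \<in> {0..1}"
    using assms wz unfolding s_def s'_def by (auto simp: field_simps)
  have cancel: "a * d / (2 * e) * (2 / d) = a / e" "a * d / (2 * e) * (2 * w / d) = a * w / e"
    if "d \<noteq> 0" for a d e
    using that by simp_all
  have s_mu: "s * (\<mu> - 1) = (1 + z) / (w - z)" "s * (\<mu> + 1) = (1 + z) * w / (w - z)"
    "s' * (\<mu> - 1) = (1 - z) / (w + z)" "s' * (\<mu> + 1) = (1 - z) * w / (w + z)"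
    unfolding \<mu>(2,3) s_def s'_def using assms(1) by (intro cancel; simp)+
  have r_eq: "1 + s * (\<mu> - 1) = r" "- 1 + s * (\<mu> + 1) = r * z"
    "\<mu> * (1 + s' * (\<mu> - 1)) = r'" "\<mu> * (1 - s' * (\<mu> + 1)) = r' * z"
    unfolding s_mu using wz by (simp_all add: r_def r'_def field_simps)
  have "chord (1, - h) (\<mu>, \<mu> * h) s = (1 + s * (\<mu> - 1), h * (- 1 + s * (\<mu> + 1)))"
    by (simp add: chord_def algebra_simps)
  then have f: "chord (1, - h) (\<mu>, \<mu> * h) s = r *\<^sub>R (1, h * z)"
    unfolding r_eq by simp
  have "chord (\<mu>, \<mu> * h) (\<mu>\<^sup>2, - (\<mu>\<^sup>2 * h)) s' =
      (\<mu> * (1 + s' * (\<mu> - 1)), h * (\<mu> * (1 - s' * (\<mu> + 1))))"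
    by (simp add: chord_def power2_eq_square algebra_simps)
  then have g: "chord (\<mu>, \<mu> * h) (\<mu>\<^sup>2, - (\<mu>\<^sup>2 * h)) s' = r' *\<^sub>R (1, h * z)"
    unfolding r_eq by simp
  have "D + s * (D * (\<mu> - 1)) = D * (1 + s * (\<mu> - 1))"
    "D * \<mu> + s' * (D * (\<mu> * (\<mu> - 1))) = D * (\<mu> * (1 + s' * (\<mu> - 1)))"
    by (simp_all add: algebra_simps)
  then have lengths: "D + s * (D * (\<mu> - 1)) = D * r" "D * \<mu> + s' * (D * (\<mu> * (\<mu> - 1))) = D * r'"
    unfolding r_eq by simp_all
  have r_pos: "r > 0" "r' > 0"
    using assms(1) wz \<mu>(1) by (auto simp: r_def r'_def)
  have U: "(1 :: real, h * z) \<noteq> 0"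
    by (simp add: zero_prod_def)
  have E: "\<mu>\<^sup>2 > 1"
    using \<mu>(1) by (intro one_less_power) auto
  obtain n where n: "\<mu>\<^sup>2 powi (n - 1) * r < x" "x \<le> \<mu>\<^sup>2 powi n * r"
    using ex_power_int_bracket[OF E r_pos(1) assms(3)] by blast
  have E_n: "\<mu>\<^sup>2 powi n = \<mu>\<^sup>2 * \<mu>\<^sup>2 powi (n - 1)"
    using \<mu>(1) by (intro power_int_eq_mult) simp
  have K_pos: "K > 0"
    using K(1) wz by (meson divide_pos_pos less_le_trans)
  show ?thesis
  \<comment> \<open>The point lies beyond the first visit of round \<open>n - 1\<close>; the next
    visits are on the second leg of that round and on the first leg of round
    \<open>n\<close>.\<close>
  proof (cases "x \<le> \<mu>\<^sup>2 powi (n - 1) * r'")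
    case True
    have "exposure_time (zigzag h w) c (x *\<^sub>R (1, h * z)) \<le> ennreal (\<mu>\<^sup>2 powi (n - 1) * (D * r') / c)"
      using exposure_time_le(2)[OF s(2) assms(2) U assms(3) True g] unfolding zigzag lengths .
    also have "r' = \<mu> * ((w - z) / (w + z)) * r"
      using wz by (simp add: r_def r'_def)
    also have "\<mu>\<^sup>2 powi (n - 1) * (D * (\<mu> * ((w - z) / (w + z)) * r)) / c
        = D * \<mu> * ((w - z) / (w + z)) * (\<mu>\<^sup>2 powi (n - 1) * r) / c"
      by (simp add: mult_ac)
    also have "ennreal \<dots> \<le> ennreal (D * \<mu> * K * x / c)"
      using K(1) n(1) wz D \<mu>(1) r_pos K_pos assms(2)
      by (intro ennreal_leI divide_right_mono mult_mono) auto
    finally show ?thesis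
      by (simp only: D_def \<mu>_def)
  next
    case False
    have "exposure_time (zigzag h w) c (x *\<^sub>R (1, h * z)) \<le> ennreal (\<mu>\<^sup>2 powi n * (D * r) / c)"
      using exposure_time_le(1)[OF s(1) assms(2) U assms(3) n(2) f] unfolding zigzag lengths .
    also have "\<mu>\<^sup>2 powi n * (D * r) = D * (\<mu>\<^sup>2 * r) * \<mu>\<^sup>2 powi (n - 1)"
      by (simp add: E_n mult_ac)
    also have "\<mu>\<^sup>2 * r = \<mu> * ((w + z) / (w - z)) * r'"
      using wz by (simp add: r_def r'_def power2_eq_square)
    also have "D * (\<mu> * ((w + z) / (w - z)) * r') * \<mu>\<^sup>2 powi (n - 1) / c
        = D * \<mu> * ((w + z) / (w - z)) * (\<mu>\<^sup>2 powi (n - 1) * r') / c"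
      by (simp add: mult_ac)
    also have "ennreal \<dots> \<le> ennreal (D * \<mu> * K * x / c)"
      using K(2) False wz D \<mu>(1) r_pos K_pos assms(2)
      by (intro ennreal_leI divide_right_mono mult_mono) auto
    finally show ?thesis
      by (simp only: D_def \<mu>_def)
  qed
qed

text \<open>The near-worst points of the cut spiral lie on the negative axis, and the zigzag must
  not expose them earlier.\<close>

lemma zigzag_exposure_time_left_half_plane:
  assumes "w > 1" "c > 0" "fst A \<le> 0"
  shows "exposure_time (zigzag h w) c A = \<infinity>"
proof -
  define \<mu> where "\<mu> = (w + 1) / (w - 1)"
  have \<mu>: "\<mu> > 1"
    using assms(1) by (simp add: \<mu>_def)
  then have "\<mu>\<^sup>2 \<ge> \<mu>"
    by (intro self_le_power) auto
  interpret self_similar_curve "\<mu>\<^sup>2" "chord (1, - h) (\<mu>, \<mu> * h)" "chord (\<mu>, \<mu> * h) (\<mu>\<^sup>2, - (\<mu>\<^sup>2 * h))"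
    "\<lambda>_. (\<mu>, \<mu> * h) - (1, - h)" "\<lambda>_. (\<mu>\<^sup>2, - (\<mu>\<^sup>2 * h)) - (\<mu>, \<mu> * h)"
    "\<lambda>s. sqrt (1 + h\<^sup>2 * w\<^sup>2) + s * (sqrt (1 + h\<^sup>2 * w\<^sup>2) * (\<mu> - 1))"
    "\<lambda>s. sqrt (1 + h\<^sup>2 * w\<^sup>2) * \<mu> + s * (sqrt (1 + h\<^sup>2 * w\<^sup>2) * (\<mu> * (\<mu> - 1)))"
    unfolding \<mu>_def by (rule zigzag_locale[OF assms(1)])
  have "fst (zigzag h w t) > 0" for t
    using \<mu> \<open>\<mu>\<^sup>2 \<ge> \<mu>\<close>
    by (cases t rule: self_similar_cases)
      (auto simp: zigzag_def Let_def self_similar_values chord_def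
        intro!: mult_pos_pos add_pos_nonneg simp flip: \<mu>_def)
  moreover have "fst P \<le> 0" if "exposes P A" for P
    using that assms(3) by (auto elim!: exposesE simp: mult_le_0_iff)
  ultimately have "\<not> exposes (zigzag h w t) A" for t
    by (meson not_le)
  then show ?thesis
    by (simp add: exposure_time_def)
qed

text \<open>On the arc the length is a fixed multiple of the radius, and each direction outside the
  wedge recurs with the radius enlarged by the growth of one round, so one bound serves all these
  directions.\<close>

lemma cut_spiral_exposure_time_le:
  fixes \<phi> l :: real
  defines "k \<equiv> spiral_rate \<phi> l"
  assumes "0 < \<phi>" "\<phi> < pi" "l > 1" "\<phi> / 2 \<le> \<psi>" "\<psi> \<le> 2 * pi - \<phi> / 2" "y > 0"
  shows "exposure_time (cut_spiral \<phi> l) 1 (y *\<^sub>R polar 1 \<psi>)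
    \<le> ennreal (sqrt (1 + 1 / k\<^sup>2) * (l * exp ((2 * pi - \<phi>) * k)) * y)"
proof -
  define M where "M = exp (k * (2 * pi - \<phi>))"
  interpret self_similar_curve "l * M" "spiral_arc 1 k (\<phi> / 2) (2 * pi - \<phi>)"
    "chord (polar M (- (\<phi> / 2))) (polar (l * M) (\<phi> / 2))"
    "spiral_velocity 1 k (\<phi> / 2) (2 * pi - \<phi>)" "\<lambda>_. polar (l * M) (\<phi> / 2) - polar M (- (\<phi> / 2))"
    "spiral_length 1 k (2 * pi - \<phi>)"
    "\<lambda>s. sqrt (1 + 1 / k\<^sup>2) * M + s * (sqrt (1 + 1 / k\<^sup>2) * M * (l - 1))"
    unfolding M_def k_def by (rule cut_spiral_locale[OF assms(2-4)])
  define q where "q = sqrt (1 + 1 / k\<^sup>2)"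
  define s where "s = (\<psi> - \<phi> / 2) / (2 * pi - \<phi>)"
  define r where "r = exp (k * (2 * pi - \<phi>) * s)"
  have w: "2 * pi - \<phi> > 0"
    using assms(3) pi_gt_zero by linarith
  have s: "s \<in> {0..1}" "\<phi> / 2 + (2 * pi - \<phi>) * s = \<psi>"
    using w assms(5,6) by (auto simp: s_def field_simps)
  obtain n where n: "(l * M) powi (n - 1) * r < y" "y \<le> (l * M) powi n * r"
    using ex_power_int_bracket[OF E _ assms(7), of r] by (auto simp: r_def)
  have E_n: "(l * M) powi n = (l * M) * (l * M) powi (n - 1)"
    using E by (intro power_int_eq_mult) linarith
  have "spiral_arc 1 k (\<phi> / 2) (2 * pi - \<phi>) s = r *\<^sub>R polar 1 \<psi>"
    by (simp add: spiral_arc_eq r_def s(2))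
  then have "exposure_time (cut_spiral \<phi> l) 1 (y *\<^sub>R polar 1 \<psi>)
      \<le> ennreal ((l * M) powi n * spiral_length 1 k (2 * pi - \<phi>) s / 1)"
    unfolding cut_spiral_def Let_def k_def[symmetric] M_def[symmetric]
    by (intro exposure_time_le(1)[OF s(1) _ _ assms(7) n(2)]) auto
  also have "(l * M) powi n * spiral_length 1 k (2 * pi - \<phi>) s / 1
      = q * (l * M) * ((l * M) powi (n - 1) * r)"
    unfolding E_n by (simp add: spiral_length_def q_def r_def)
  also have "ennreal \<dots> \<le> ennreal (q * (l * M) * y)"
    using n(1) E by (intro ennreal_leI mult_left_mono) (auto simp: q_def)
  finally show ?thesis
    by (simp only: q_def M_def mult.commute[of k])
qed

text \<open>The point lies beyond the visit of the arc in round 0, so the arc exposes it only in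
  rounds \<open>n \<ge> 1\<close>; the chord stays in the right half plane.\<close>

lemma cut_spiral_exposure_time_ge:
  fixes \<phi> l :: real
  defines "k \<equiv> spiral_rate \<phi> l"
  assumes "0 < \<phi>" "\<phi> < pi" "l > 1" "y > exp (k * (pi - \<phi> / 2))"
  shows "ennreal (sqrt (1 + 1 / k\<^sup>2) * (l * exp ((2 * pi - \<phi>) * k)) * exp (k * (pi - \<phi> / 2)))
    \<le> exposure_time (cut_spiral \<phi> l) 1 (- y, 0)"
proof -
  define M where "M = exp (k * (2 * pi - \<phi>))"
  interpret self_similar_curve "l * M" "spiral_arc 1 k (\<phi> / 2) (2 * pi - \<phi>)"
    "chord (polar M (- (\<phi> / 2))) (polar (l * M) (\<phi> / 2))"
    "spiral_velocity 1 k (\<phi> / 2) (2 * pi - \<phi>)" "\<lambda>_. polar (l * M) (\<phi> / 2) - polar M (- (\<phi> / 2))"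
    "spiral_length 1 k (2 * pi - \<phi>)"
    "\<lambda>s. sqrt (1 + 1 / k\<^sup>2) * M + s * (sqrt (1 + 1 / k\<^sup>2) * M * (l - 1))"
    unfolding M_def k_def by (rule cut_spiral_locale[OF assms(2-4)])
  define q where "q = sqrt (1 + 1 / k\<^sup>2)"
  define r where "r = exp (k * (pi - \<phi> / 2))"
  have w: "2 * pi - \<phi> > 0"
    using assms(3) pi_gt_zero by linarith
  have r: "r > 0"
    by (simp add: r_def)
  then have y: "y > 0"
    using assms(5) unfolding r_def[symmetric] by linarith
  have M: "M > 0"
    by (simp add: M_def)
  have "ennreal (q * (l * M) * r / 1) \<le> exposure_time (cut_spiral \<phi> l) 1 (- y, 0)"
    unfolding cut_spiral_def Let_def k_def[symmetric] M_def[symmetric]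
  proof (rule exposure_time_ge)
    fix n s assume s: "0 \<le> s" "s < (1::real)"
      and ex: "exposes ((l * M) powi n *\<^sub>R spiral_arc 1 k (\<phi> / 2) (2 * pi - \<phi>) s) (- y, 0)"
    obtain d where d: "d \<ge> 1"
        "(l * M) powi n *\<^sub>R spiral_arc 1 k (\<phi> / 2) (2 * pi - \<phi>) s = d *\<^sub>R (- y, 0)"
      using ex by (rule exposesE)
    define a where "a = \<phi> / 2 + (2 * pi - \<phi>) * s"
    define p where "p = (l * M) powi n * exp (k * (2 * pi - \<phi>) * s)"
    have "p > 0"
      using E by (simp add: p_def)
    have pa: "p * cos a = - (d * y)" "p * sin a = 0"
      using d(2) by (simp_all add: spiral_arc_def polar_def p_def a_def)
    then have sa: "sin a = 0"
      using \<open>p > 0\<close> by simp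
    have "(2 * pi - \<phi>) * s < (2 * pi - \<phi>) * 1"
      using w s by (intro mult_strict_left_mono)
    moreover have "0 \<le> (2 * pi - \<phi>) * s"
      using w s by simp
    moreover have "a = \<phi> / 2 + (2 * pi - \<phi>) * s"
      by (rule a_def)
    ultimately have a: "0 < a" "a < 2 * pi"
      using assms(2) unfolding mult_1_right by linarith+
    have "a = pi"
    proof (rule ccontr)
      assume "a \<noteq> pi"
      then consider "a < pi" | "pi < a"
        by linarith
      then show False
        using sin_gt_zero[of a] sin_lt_zero[of a] a sa by cases auto
    qed
    then have "(2 * pi - \<phi>) * s = pi - \<phi> / 2"
      by (simp add: a_def)
    then have p: "p = (l * M) powi n * r"
      by (simp add: p_def r_def mult.assoc)
    have "p = d * y"
      using pa(1) \<open>a = pi\<close> by simp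
    then have "y \<le> (l * M) powi n * r"
      using d(1) y unfolding p[symmetric] by simp
    then have "r < (l * M) powi n * r"
      using assms(5) unfolding r_def by linarith
    then have "(l * M) powi n > 1"
      using r by simp
    then have "1 \<le> n"
      using E by (intro power_int_gt_1D)
    then have "(l * M) powi 1 \<le> (l * M) powi n"
      using E by (intro power_int_increasing) auto
    have "q * (l * M) * r = (l * M) powi 1 * (q * r)"
      by simp
    also have "\<dots> \<le> (l * M) powi n * (q * r)"
      using \<open>(l * M) powi 1 \<le> (l * M) powi n\<close> r by (intro mult_right_mono) (auto simp: q_def)
    also have "q * r = spiral_length 1 k (2 * pi - \<phi>) s"
      using \<open>(2 * pi - \<phi>) * s = pi - \<phi> / 2\<close> by (simp add: spiral_length_def q_def r_def mult.assoc)
    finally show "q * (l * M) * r \<le> (l * M) powi n * spiral_length 1 k (2 * pi - \<phi>) s" .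
  next
    fix n s assume s: "0 \<le> s" "s < (1::real)"
      and ex: "exposes ((l * M) powi n *\<^sub>R chord (polar M (- (\<phi> / 2))) (polar (l * M) (\<phi> / 2)) s) (- y, 0)"
    obtain d where d: "d \<ge> 1"
        "(l * M) powi n *\<^sub>R chord (polar M (- (\<phi> / 2))) (polar (l * M) (\<phi> / 2)) s = d *\<^sub>R (- y, 0)"
      using ex by (rule exposesE)
    have "cos (\<phi> / 2) > 0"
      using assms by (intro cos_gt_zero_pi) auto
    then have "(l * M) powi n * (M * cos (\<phi> / 2) * (1 + s * (l - 1))) > 0"
      using E M s assms(4) by (intro mult_pos_pos add_pos_nonneg) auto
    moreover have "(l * M) powi n * (M * cos (\<phi> / 2) * (1 + s * (l - 1))) = - (d * y)"
      using arg_cong[OF d(2), of fst] by (simp add: chord_def polar_def algebra_simps)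
    moreover have "d * y > 0"
      using d(1) y by simp
    ultimately show "q * (l * M) * r \<le> (l * M) powi n *
        (sqrt (1 + 1 / k\<^sup>2) * M + s * (sqrt (1 + 1 / k\<^sup>2) * M * (l - 1)))"
      by linarith
  qed (use r E in \<open>auto simp: q_def\<close>)
  then show ?thesis
    by (simp add: q_def r_def M_def mult.commute[of k])
qed

lemma wedge_search_admits:
  fixes \<phi> l :: real
  defines "h \<equiv> tan (\<phi> / 2)" and "k \<equiv> spiral_rate \<phi> l"
  assumes "0 < \<phi>" "\<phi> < pi" "l > 1" "w > 1" "h * w \<le> 4" "c > 0"
    and S: "S = sqrt (1 + 1 / k\<^sup>2) * (l * exp ((2 * pi - \<phi>) * k))"
    and cS: "c * S = zigzag_cost h w / sqrt (1 + h\<^sup>2)"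
  shows "MSP_admits punctured_plane 2 (\<lambda>i. [1, c] ! i) S"
proof (rule MSP2_admitsI)
  show "search_curve (cut_spiral \<phi> l)"
    unfolding cut_spiral_def Let_def
    by (rule self_similar_curve.search_curve[OF cut_spiral_locale[OF assms(3-5)]])
  show "search_curve (zigzag h w)"
    unfolding zigzag_def Let_def
    by (rule self_similar_curve.search_curve[OF zigzag_locale[OF assms(6)]])
  show "S \<ge> 0"
    using assms(5) by (simp add: S)
  have h: "h > 0"
    unfolding h_def using assms by (intro tan_gt_zero) auto
  fix A :: "real \<times> real" assume "A \<noteq> 0"
  show "exposure_time (cut_spiral \<phi> l) 1 A \<le> ennreal (S * norm A) \<or>
      exposure_time (zigzag h w) c A \<le> ennreal (S * norm A)"
  proof (cases "fst A > 0 \<and> \<bar>snd A\<bar> \<le> h * fst A")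
    case True
    define x where "x = fst A"
    define z where "z = snd A / (h * x)"
    have x: "x > 0"
      using True by (simp add: x_def)
    have A: "A = x *\<^sub>R (1, h * z)"
      using x h by (simp add: prod_eq_iff x_def z_def)
    have z: "- 1 \<le> z" "z \<le> 1"
      using True x h by (auto simp: z_def x_def abs_le_iff field_simps)
    define N where "N = sqrt (1 + h\<^sup>2 * z\<^sup>2)"
    have "N > 0"
      by (simp add: N_def add_pos_nonneg)
    have norm: "norm A = x * N"
      using x unfolding A norm_scaleR by (simp add: norm_Pair N_def power_mult_distrib)
    \<comment> \<open>The factor \<open>N\<close> converts a bound in the first coordinate into one
      in \<open>norm A\<close>.\<close>
    define K where "K = (w + 1) / ((w - 1) * sqrt (1 + h\<^sup>2)) * N"
    have "(w - z) / (w + z) \<le> K" "(w + z) / (w - z) \<le> K"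
      using zigzag_direction_bound[OF h assms(6,7) z] zigzag_direction_bound[OF h assms(6,7), of "- z"]
        z \<open>N > 0\<close>
      unfolding K_def by (simp_all add: pos_divide_le_eq flip: divide_divide_eq_left N_def)
    then have "exposure_time (zigzag h w) c A
        \<le> ennreal (sqrt (1 + h\<^sup>2 * w\<^sup>2) * ((w + 1) / (w - 1)) * K * x / c)"
      unfolding A by (intro zigzag_exposure_time_le assms x z)
    also have "sqrt (1 + h\<^sup>2 * w\<^sup>2) * ((w + 1) / (w - 1)) * K * x = c * S * norm A"
      unfolding cS by (simp add: zigzag_cost_def K_def norm power2_eq_square mult_ac)
    also have "c * S * norm A / c = S * norm A"
      using assms(8) by simp
    finally show ?thesis ..
  next
    case False
    obtain \<psi> where \<psi>: "0 \<le> \<psi>" "\<psi> < 2 * pi" "A = polar (norm A) \<psi>"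
      by (rule polar_form)
    define y where "y = norm A"
    have y: "y > 0" and A: "A = y *\<^sub>R polar 1 \<psi>"
      using \<open>A \<noteq> 0\<close> \<psi>(3) polar_scaleR[of y \<psi>] by (auto simp: y_def)
    \<comment> \<open>A direction strictly within \<open>\<phi> / 2\<close> of the axis would put
      \<open>A\<close> in the wedge; \<open>b\<close> will be \<open>\<psi>\<close> for one side of
      the axis and \<open>2 * pi - \<psi>\<close> for the other.\<close>
    have wedge: False if "\<bar>b\<bar> < \<phi> / 2" "cos b = cos \<psi>" "\<bar>sin b\<bar> = \<bar>sin \<psi>\<bar>" for b
    proof -
      have "cos b > 0"
        using that(1) assms(4) by (intro cos_gt_zero_pi) auto
      moreover have "\<bar>tan b\<bar> \<le> h"
      proof -
        have "tan b < h" "tan (- b) < h"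
          unfolding h_def using that(1) assms(4) by (auto intro!: tan_monotone simp del: tan_minus)
        then show ?thesis
          by simp
      qed
      then have "\<bar>sin b\<bar> \<le> h * cos b"
        using \<open>cos b > 0\<close> by (simp add: tan_def abs_divide pos_divide_le_eq)
      then have "y * \<bar>sin b\<bar> \<le> y * (h * cos b)"
        using y by (intro mult_left_mono) auto
      ultimately show False
        using False y that(2,3) by (simp add: A polar_def abs_mult mult_ac)
    qed
    have "\<phi> / 2 \<le> \<psi>"
      using wedge[of \<psi>] \<psi>(1) by (cases "\<phi> / 2 \<le> \<psi>") auto
    moreover have "\<psi> \<le> 2 * pi - \<phi> / 2"
      using wedge[of "2 * pi - \<psi>"] \<psi>(2) by (cases "\<psi> \<le> 2 * pi - \<phi> / 2") (auto simp: cos_diff sin_diff)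
    ultimately have "exposure_time (cut_spiral \<phi> l) 1 A \<le> ennreal (S * y)"
      unfolding A S k_def by (intro cut_spiral_exposure_time_le assms y)
    then show ?thesis
      by (simp add: y_def)
  qed
next
  fix e :: real assume e: "e > 0"
  define r where "r = exp (k * (pi - \<phi> / 2))"
  have "r > 0"
    by (simp add: r_def)
  \<comment> \<open>Just beyond the crossing of the negative axis by the spiral in round 0.\<close>
  let ?A = "(- (r * (1 + e)), 0) :: real \<times> real"
  have "S * norm ?A / (1 + e) = S * r"
    using \<open>r > 0\<close> e by (simp add: norm_Pair)
  moreover have "ennreal (S * r) \<le> exposure_time (cut_spiral \<phi> l) 1 ?A"
    unfolding S k_def r_def using \<open>r > 0\<close> e
    by (intro cut_spiral_exposure_time_ge assms) (auto simp: r_def k_def)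
  moreover have "exposure_time (zigzag h w) c ?A = \<infinity>"
    using \<open>r > 0\<close> e assms(6,8) by (intro zigzag_exposure_time_left_half_plane) auto
  ultimately show "\<exists>A. A \<noteq> 0 \<and>
      ennreal (S * norm A / (1 + e)) \<le> exposure_time (cut_spiral \<phi> l) 1 A \<and>
      ennreal (S * norm A / (1 + e)) \<le> exposure_time (zigzag h w) c A"
    using \<open>r > 0\<close> e by (intro exI[of _ ?A]) (auto simp: zero_prod_def)
qed

theorem theorem5:
  fixes \<phi> :: real
  assumes "\<phi> \<in> {0<..<pi}"
  shows "MSP_admits punctured_plane 2 (\<lambda>i. [1, speed_ratio \<phi>] ! i) (R_min \<phi>)
       \<and> R_min \<phi> = cos (\<phi> / 2) * F_min \<phi> / speed_ratio \<phi>"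
proof -
  have \<phi>: "0 < \<phi>" "\<phi> < pi"
    using assms by auto
  define h where "h = tan (\<phi> / 2)"
  have h: "h > 0"
    unfolding h_def using \<phi> by (intro tan_gt_zero) auto
  obtain w where w: "w > 1" "F_min \<phi> = zigzag_cost h w"
      "\<And>v. v > 1 \<Longrightarrow> zigzag_cost h w \<le> zigzag_cost h v"
    unfolding h_def using F_min_eq[OF \<phi>] by blast
  obtain l where l: "l > 1" and R: "R_min \<phi> = sqrt (l\<^sup>2 - 2 * l * cos \<phi> + 1) / (l - 1) *
      (l * exp ((2 * pi - \<phi>) * spiral_rate \<phi> l))"
    using R_min_eq[OF \<phi>] by blast
  have R_ge: "12 \<le> R_min \<phi>"
    by (rule R_min_ge_12[OF \<phi>])
  have "cos (\<phi> / 2) > 0"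
    using \<phi> by (intro cos_gt_zero_pi) auto
  then have "sqrt (1 + h\<^sup>2) = 1 / cos (\<phi> / 2)"
    unfolding h_def using tan_sec[of "\<phi> / 2"] by (simp add: inverse_eq_divide)
  then have cR: "speed_ratio \<phi> * R_min \<phi> = zigzag_cost h w / sqrt (1 + h\<^sup>2)"
    using R_ge by (simp add: speed_ratio_def w(2))
  have F: "F_min \<phi> > 0"
    unfolding w(2) zigzag_cost_def using w(1) by (intro mult_pos_pos) (auto simp: add_pos_nonneg)
  then have c: "speed_ratio \<phi> > 0"
    unfolding speed_ratio_def using R_ge \<open>cos (\<phi> / 2) > 0\<close> by (intro mult_pos_pos divide_pos_pos) auto
  have "MSP_admits punctured_plane 2 (\<lambda>i. [1, speed_ratio \<phi>] ! i) (R_min \<phi>)"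
  proof (cases "h \<le> 3 / 4")
    case True
    show ?thesis
      using wedge_search_admits[OF \<phi> l w(1) _ c R[unfolded chord_ratio(2)[OF \<phi> l]]]
        minimizer_slope_le_4[OF h True w(1,3)] cR unfolding h_def by blast
  next
    case False
    have cR_ge: "34 / 5 \<le> speed_ratio \<phi> * R_min \<phi>"
      unfolding cR using False w(1) by (intro zigzag_cost_ge) auto
    \<comment> \<open>The product is \<open>408 / 5\<close>, the threshold of the two-spiral
      construction.\<close>
    have "34 / 5 * 12 \<le> (speed_ratio \<phi> * R_min \<phi>) * R_min \<phi>"
      using cR_ge R_ge by (intro mult_mono) auto
    then show ?thesis
      using cR_ge R_ge c by (intro two_spirals_admit) (auto simp: power2_eq_square mult.assoc)
  qed
  moreover have "R_min \<phi> = cos (\<phi> / 2) * F_min \<phi> / speed_ratio \<phi>"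
    using F R_ge \<open>cos (\<phi> / 2) > 0\<close> by (simp add: speed_ratio_def)
  ultimately show ?thesis ..
qed

end
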